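(* The $2$-$3$-ECBGC problem ($2$-$3$ edge constrained bipartite graph coloring) is solvable in polynomial time when restricted to instances $(G=(U,V,E),pc)$ whose function of permitted color combinations satisfies the following: for every $j\in V$ there exist $a_j,b_j\in\{1,2,3\}$, $a_j\neq b_j$, such that for all $i\in U$ with $(i,j)\in E$, $$pc(i,j,a_j,1)=pc(i,j,b_j,2)=\text{``}+\text{''}\iff pc(i,j,a_j,2)=pc(i,j,b_j,1)=\text{``}+\text{''}.$$
   Context: $2$-$3$-ECBGC problem: given a finite bipartite graph $G=(U,V,E)$ with parts $U$ and $V$, and a function $pc$ of permitted color combinations assigning $+$ or $-$ to each triple consisting of an edge, a color in $\{1,2\}$ for its endpoint in $U$, and a color in $\{1,2,3\}$ for its endpoint in $V$, determine whether there exist colorings $color:U\to\{1,2\}$ and $color:V\to\{1,2,3\}$ satisfying the constraints of all the edges. For an edge $(i,j)$ with $i\in U$, $j\in V$, we write $pc(i,j,k,s)\in\{+,-\}$ where $k\in\{1,2,3\}$ is the color of $j$ and $s\in\{1,2\}$ is the color of $i$; a coloring satisfies the constraint of the edge $(i,j)$ if $pc(i,j,color(j),color(i))=+$. The condition "$pc(\cdot)=pc(\cdot)=$ ``$+$''" means both values are $+$. *)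

theory Defs
  imports Main "HOL-Library.FuncSet" "HOL-Library.Log_Nat"
    "HOL-Computational_Algebra.Polynomial"
begin

text \<open>
  Polynomial time is understood with respect to the random access machine of Cook and Reckhow
  under the logarithmic cost criterion, which is polynomially equivalent to multitape Turing
  machines. Registers hold natural numbers, subtraction is truncated, and the input is a bit
  string that is read sequentially.
\<close>

datatype instr =
    Const nat nat      \<comment> \<open>\<open>X\<^sub>i := c\<close>\<close>
  | Add nat nat nat    \<comment> \<open>\<open>X\<^sub>i := X\<^sub>j + X\<^sub>k\<close>\<close>
  | Sub nat nat nat    \<comment> \<open>\<open>X\<^sub>i := X\<^sub>j - X\<^sub>k\<close>\<close>
  | Load nat nat       \<comment> \<open>\<open>X\<^sub>i := X\<^bsub>X\<^sub>j\<^esub>\<close>\<close>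
  | Store nat nat      \<comment> \<open>\<open>X\<^bsub>X\<^sub>i\<^esub> := X\<^sub>j\<close>\<close>
  | Jump_pos nat nat   \<comment> \<open>\<open>Jump_pos i m\<close>: if \<open>X\<^sub>i > 0\<close> go to instruction \<open>m\<close>\<close>
  | Read nat           \<comment> \<open>\<open>X\<^sub>i :=\<close> next input bit, or 2 if the input is exhausted\<close>

text \<open>Configurations: program counter, register contents, unread part of the input.\<close>

type_synonym config = "nat \<times> (nat \<Rightarrow> nat) \<times> bool list"

fun exec :: "instr \<Rightarrow> config \<Rightarrow> config" where
  "exec (Const i c) (l, r, w) = (Suc l, r(i := c), w)"
| "exec (Add i j k) (l, r, w) = (Suc l, r(i := r j + r k), w)"
| "exec (Sub i j k) (l, r, w) = (Suc l, r(i := r j - r k), w)"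
| "exec (Load i j) (l, r, w) = (Suc l, r(i := r (r j)), w)"
| "exec (Store i j) (l, r, w) = (Suc l, r(r i := r j), w)"
| "exec (Jump_pos i m) (l, r, w) = (if r i > 0 then m else Suc l, r, w)"
| "exec (Read i) (l, r, w) =
     (Suc l, r(i := (case w of [] \<Rightarrow> 2 | b # _ \<Rightarrow> of_bool b)), tl w)"

text \<open>The number of binary digits of a number, where 0 is counted as having one digit.\<close>

definition bits :: "nat \<Rightarrow> nat" where
  "bits n = max 1 (floorlog 2 n)"

fun cost :: "instr \<Rightarrow> (nat \<Rightarrow> nat) \<Rightarrow> nat" where
  "cost (Const i c) r = bits c"
| "cost (Add i j k) r = bits (r j) + bits (r k)"
| "cost (Sub i j k) r = bits (r j) + bits (r k)"
| "cost (Load i j) r = bits (r j) + bits (r (r j))"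
| "cost (Store i j) r = bits (r i) + bits (r j)"
| "cost (Jump_pos i m) r = bits (r i)"
| "cost (Read i) r = 1"

inductive run :: "instr list \<Rightarrow> config \<Rightarrow> nat \<Rightarrow> config \<Rightarrow> bool" for P where
  run_refl: "run P c 0 c"
| run_step: "l < length P \<Longrightarrow> run P (exec (P ! l) (l, r, w)) t c \<Longrightarrow>
    run P (l, r, w) (cost (P ! l) r + t) c"

text \<open>
  A computation starts with all registers zero and halts when the program counter leaves the
  program; the answer (1 for yes, 0 for no) is then found in register 0.
\<close>

definition answers_in_time :: "instr list \<Rightarrow> bool list \<Rightarrow> nat \<Rightarrow> bool \<Rightarrow> bool" where
  "answers_in_time P w t b \<longleftrightarrow>
     (\<exists>l r v. run P (0, \<lambda>_. 0, w) t (l, r, v) \<and> length P \<le> l \<and> r 0 = of_bool b)"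

text \<open>
  The decision problem \<open>Q\<close>, restricted to the instances in \<open>A\<close>, with instances presented via
  \<open>enc\<close>. Nothing is required of the program on inputs that do not encode an instance in \<open>A\<close>.
\<close>

definition poly_time_solvable_on ::
    "'i set \<Rightarrow> ('i \<Rightarrow> bool list) \<Rightarrow> ('i \<Rightarrow> bool) \<Rightarrow> bool" where
  "poly_time_solvable_on A enc Q \<longleftrightarrow>
     (\<exists>(P :: instr list) (p :: nat poly). \<forall>x\<in>A.
        \<exists>t \<le> poly p (length (enc x)). answers_in_time P (enc x) t (Q x))"


datatype sign = Plus | Minus

text \<open>
  The parts of the graph are \<open>U = {..<nU}\<close> and \<open>V = {..<nV}\<close>, regarded as disjoint; \<open>(i, j)\<close> in
  \<open>edges\<close> joins \<open>i\<close> in \<open>U\<close> to \<open>j\<close> in \<open>V\<close>. In \<open>pc i j k s\<close>, \<open>k\<close> is the color of \<open>j\<close> and \<open>s\<close> the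
  color of \<open>i\<close>; only values at edges and at colors \<open>k \<in> {1, 2, 3}\<close>, \<open>s \<in> {1, 2}\<close> matter.
\<close>

record ecbgc =
  nU :: nat
  nV :: nat
  edges :: "(nat \<times> nat) set"
  pc :: "nat \<Rightarrow> nat \<Rightarrow> nat \<Rightarrow> nat \<Rightarrow> sign"

definition ecbgc_instance :: "ecbgc \<Rightarrow> bool" where
  "ecbgc_instance I \<longleftrightarrow> edges I \<subseteq> {..<nU I} \<times> {..<nV I}"

definition ecbgc_colorable :: "ecbgc \<Rightarrow> bool" where
  "ecbgc_colorable I \<longleftrightarrow>
     (\<exists>colU \<in> {..<nU I} \<rightarrow> {1, 2}. \<exists>colV \<in> {..<nV I} \<rightarrow> {1, 2, 3}.
        \<forall>(i, j) \<in> edges I. pc I i j (colV j) (colU i) = Plus)"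

text \<open>
  The sizes of the two parts in unary, followed by the bipartite adjacency matrix in row-major
  order. Each matrix entry consists of an edge bit and the six values of \<open>pc\<close>, which are set to
  \<open>False\<close> at non-edges.
\<close>

definition encode_entry :: "ecbgc \<Rightarrow> nat \<Rightarrow> nat \<Rightarrow> bool list" where
  "encode_entry I i j =
     ((i, j) \<in> edges I) #
     [(i, j) \<in> edges I \<and> pc I i j k s = Plus. k \<leftarrow> [1, 2, 3], s \<leftarrow> [1, 2]]"

definition encode_ecbgc :: "ecbgc \<Rightarrow> bool list" where
  "encode_ecbgc I =
     replicate (nU I) True @ [False] @ replicate (nV I) True @ [False] @
     concat [encode_entry I i j. i \<leftarrow> [0..<nU I], j \<leftarrow> [0..<nV I]]"

end

theory Submission
  imports Defs
begin

text \<open>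
  At a vertex \<open>j\<close> of \<open>V\<close>, either one of the colors \<open>a\<^sub>j\<close>, \<open>b\<^sub>j\<close> is excluded by a single edge,
  whatever color its other endpoint has, or both impose the same constraint on every edge. In each
  case one of them can be dropped, and \<open>j\<close> has two colors left, \<open>k\<close> and \<open>k'\<close>. It can be colored
  iff no neighbor forbids \<open>k\<close> while another one forbids \<open>k'\<close>, which is a set of 2-clauses about the
  colors of \<open>U\<close>. Thus the problem becomes an instance of 2-SAT, which is decided by the transitive
  closure of its implication graph.

  The random access machine program is compiled from a language in which all loops are bounded by
  expressions and only truth values are stored in memory. Every program of that language takes
  polynomially many steps, and in polynomially many steps with additions and subtractions numbers
  grow to polynomially many digits only.
\<close>

section \<open>Unit cost versus logarithmic cost\<close>

text \<open>The hypothesis only provides the existence of \<open>a_j\<close> and \<open>b_j\<close>,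
  and the program never searches for them. It tests each of the three colors for a property that the
  hypothesis forces on one of them: being excluded by a single edge, or being dominated by another
  color that is allowed wherever the first one is. If several colors at a vertex have this property,
  no choice is made and each of them contributes its clauses. This is sound because giving up any
  single one of them preserves colorability.\<close>

inductive steps :: "instr list \<Rightarrow> config \<Rightarrow> nat \<Rightarrow> config \<Rightarrow> bool" for P where
  steps_refl: "steps P c 0 c"
| steps_step: "l < length P \<Longrightarrow> steps P (exec (P ! l) (l, r, w)) n c \<Longrightarrow>
    steps P (l, r, w) (Suc n) c"

lemma steps_trans: "steps P c m c' \<Longrightarrow> steps P c' n c'' \<Longrightarrow> steps P c (m + n) c''"
  by (induction rule: steps.induct) (auto intro: steps.intros)

fun literal_const :: "instr \<Rightarrow> nat" where
  "literal_const (Const i c) = c"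
| "literal_const _ = 0"

lemma bits_le:
  assumes "x < 2 ^ b" "1 \<le> b"
  shows "bits x \<le> b"
  using assms by (simp add: bits_def floorlog_leI)

text \<open>One instruction at most doubles the largest register, so after \<open>n\<close> instructions all
  registers have at most \<open>b + n\<close> bits.\<close>

lemma exec_less:
  assumes "\<And>x. r x < 2 ^ b" "literal_const i < 2 ^ b" "2 \<le> b" "exec i (l, r, w) = (l', r', w')"
  shows "r' x < 2 ^ Suc b"
proof -
  have lt: "r x < 2 * 2 ^ b" for x
    using assms(1)[of x] by linarith
  \<comment> \<open>Reading past the end of the input yields 2, which must stay below the bound as
    well. This is where \<open>2 \<le> b\<close> matters.\<close>
  have "(2::nat) ^ 2 \<le> 2 ^ b"
    using assms(3) by (intro power_increasing) auto
  then have "(2::nat) < 2 ^ b"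
    by simp
  moreover have "r y + r z < 2 * 2 ^ b" "r y - r z < 2 * 2 ^ b" for y z
    using assms(1)[of y] assms(1)[of z] by linarith+
  ultimately show ?thesis
    using assms(2,4) lt by (cases i) (auto split: list.splits)
qed

lemma cost_le:
  assumes "\<And>x. r x < 2 ^ b" "literal_const i < 2 ^ b" "2 \<le> b"
  shows "cost i r \<le> 2 * b"
proof -
  have "bits (r x) \<le> b" "bits (literal_const i) \<le> b" for x
    using assms by (auto intro!: bits_le)
  then show ?thesis
    using assms(3) by (cases i) (auto intro: add_mono simp: mult_2 trans_le_add1)
qed

text \<open>The register bound worsens by one bit per instruction, so the induction passes from
  \<open>b\<close> to \<open>Suc b\<close>, and each of the \<open>n\<close> instructions costs at
  most \<open>2 * (b + n)\<close>.\<close>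

lemma steps_run:
  assumes "steps P (l, r, w) n c" "\<And>x. r x < 2 ^ b" "2 \<le> b"
    and "\<And>i. i \<in> set P \<Longrightarrow> literal_const i < 2 ^ b"
  shows "\<exists>t \<le> n * (2 * (b + n)). run P (l, r, w) t c"
  using assms
proof (induction "(l, r, w)" n c arbitrary: l r w b rule: steps.induct)
  case steps_refl
  then show ?case by (auto intro: run.intros)
next
  case (steps_step l r w n c)
  obtain l' r' w' where e: "exec (P ! l) (l, r, w) = (l', r', w')"
    by (metis prod_cases3)
  have lit: "literal_const (P ! l) < 2 ^ b"
    using steps_step by simp
  have "literal_const i < 2 ^ Suc b" if "i \<in> set P" for i
    using steps_step.prems(3)[OF that] by simp
  then obtain t where t: "t \<le> n * (2 * (Suc b + n))" "run P (l', r', w') t c"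
    using steps_step.hyps(3)[OF e, of "Suc b"] exec_less[OF steps_step.prems(1) lit _ e]
      steps_step.prems(2) by auto
  have "run P (l, r, w) (cost (P ! l) r + t) c"
    using steps_step.hyps(1) t(2) e by (auto intro: run.intros)
  moreover have "cost (P ! l) r + t \<le> Suc n * (2 * (b + Suc n))"
    using cost_le[of r b "P ! l", OF steps_step.prems(1) lit steps_step.prems(2)] t(1)
    by (simp add: algebra_simps)
  ultimately show ?case by blast
qed

section \<open>A language of bounded loops\<close>

text \<open>The bounded sum is the only binder. It serves as multiplication, existential quantifier
  and counter at once. The primes avoid a clash with the sign \<open>Plus\<close>.\<close>

datatype exp = C nat | V nat | Plus' exp exp | Minus' exp exp | Mem exp | Sum nat exp exp

fun eval :: "exp \<Rightarrow> (nat \<Rightarrow> nat) \<Rightarrow> (nat \<Rightarrow> nat) \<Rightarrow> nat" where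
  "eval (C c) s m = c"
| "eval (V x) s m = s x"
| "eval (Plus' a b) s m = eval a s m + eval b s m"
| "eval (Minus' a b) s m = eval a s m - eval b s m"
| "eval (Mem a) s m = m (eval a s m)"
| "eval (Sum x a b) s m = (\<Sum>i<eval a s m. eval b (s(x := i)) m)"

text \<open>Commands store truth values only. This keeps the memory bounded by 1, which is why every
  command runs in polynomial time.\<close>

datatype com = Asg exp exp | Seq com com | For nat exp com

fun sem :: "com \<Rightarrow> (nat \<Rightarrow> nat) \<Rightarrow> (nat \<Rightarrow> nat) \<Rightarrow> (nat \<Rightarrow> nat)" where
  "sem (Asg a b) s m = m(eval a s m := of_bool (0 < eval b s m))"
| "sem (Seq c d) s m = sem d s (sem c s m)"
| "sem (For x a c) s m = fold (\<lambda>i. sem c (s(x := i))) [0..<eval a s m] m"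

text \<open>Exact instruction counts of the compiled code. For \<open>Sum\<close>, 11 consists of 1
  to clear the accumulator, 8 to enter and leave the loop and 2 to copy the result; each round adds
  1 for the accumulation and 4 for loop control.\<close>

fun etime :: "exp \<Rightarrow> (nat \<Rightarrow> nat) \<Rightarrow> (nat \<Rightarrow> nat) \<Rightarrow> nat" where
  "etime (C c) s m = 1"
| "etime (V x) s m = 2"
| "etime (Plus' a b) s m = etime a s m + etime b s m + 1"
| "etime (Minus' a b) s m = etime a s m + etime b s m + 1"
| "etime (Mem a) s m = etime a s m + 5"
| "etime (Sum x a b) s m =
     etime a s m + 11 + (\<Sum>i<eval a s m. etime b (s(x := i)) m + 5)"

fun ctime :: "com \<Rightarrow> (nat \<Rightarrow> nat) \<Rightarrow> (nat \<Rightarrow> nat) \<Rightarrow> nat" where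
  "ctime (Asg a b) s m = etime a s m + etime b s m + 8"
| "ctime (Seq c d) s m = ctime c s m + ctime d s (sem c s m)"
| "ctime (For x a c) s m = etime a s m + 8 +
     (\<Sum>i<eval a s m. ctime c (s(x := i)) (fold (\<lambda>i. sem c (s(x := i))) [0..<i] m) + 4)"

lemma poly_mono_nat: "x \<le> y \<Longrightarrow> poly p x \<le> poly p y" for p :: "nat poly"
  by (induction p) (auto intro: mult_mono)

text \<open>Value and time are bounded together because the value of the range of a
  \<open>Sum\<close> determines how often its body is evaluated.\<close>

lemma exp_poly_bound:
  "\<exists>p. \<forall>s m M. (\<forall>x. s x \<le> M) \<longrightarrow> (\<forall>a. m a \<le> M) \<longrightarrow>
     eval e s m \<le> poly p M \<and> etime e s m \<le> poly p M"
proof (induction e)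
  case (C c)
  show ?case by (rule exI[of _ "[:c + 1:]"]) auto
next
  case (V x)
  show ?case by (rule exI[of _ "[:2, 1:]"]) (auto intro!: le_SucI)
next
  case (Plus' a b)
  then obtain p q where "\<forall>s m M. (\<forall>x. s x \<le> M) \<longrightarrow> (\<forall>a. m a \<le> M) \<longrightarrow>
     eval a s m \<le> poly p M \<and> etime a s m \<le> poly p M"
   and "\<forall>s m M. (\<forall>x. s x \<le> M) \<longrightarrow> (\<forall>a. m a \<le> M) \<longrightarrow>
     eval b s m \<le> poly q M \<and> etime b s m \<le> poly q M" by blast
  then show ?case by (intro exI[of _ "p + q + 1"]) (auto intro!: add_mono le_SucI)
next
  case (Minus' a b)
  then obtain p q where "\<forall>s m M. (\<forall>x. s x \<le> M) \<longrightarrow> (\<forall>a. m a \<le> M) \<longrightarrow>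
     eval a s m \<le> poly p M \<and> etime a s m \<le> poly p M"
   and "\<forall>s m M. (\<forall>x. s x \<le> M) \<longrightarrow> (\<forall>a. m a \<le> M) \<longrightarrow>
     eval b s m \<le> poly q M \<and> etime b s m \<le> poly q M" by blast
  then show ?case
    by (intro exI[of _ "p + q + 1"]) (simp, meson add_mono diff_le_self le_SucI le_trans trans_le_add1)
next
  case (Mem a)
  then obtain p where "\<forall>s m M. (\<forall>x. s x \<le> M) \<longrightarrow> (\<forall>a. m a \<le> M) \<longrightarrow>
     eval a s m \<le> poly p M \<and> etime a s m \<le> poly p M" by blast
  then show ?case by (intro exI[of _ "p + [:5, 1:]"]) (auto simp: trans_le_add2 intro: trans_le_add1)
next
  case (Sum x a b)
  then obtain p q where p: "\<forall>s m M. (\<forall>x. s x \<le> M) \<longrightarrow> (\<forall>a. m a \<le> M) \<longrightarrow>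
     eval a s m \<le> poly p M \<and> etime a s m \<le> poly p M"
   and q: "\<forall>s m M. (\<forall>x. s x \<le> M) \<longrightarrow> (\<forall>a. m a \<le> M) \<longrightarrow>
     eval b s m \<le> poly q M \<and> etime b s m \<le> poly q M" by blast
  \<comment> \<open>The summation variable may exceed \<open>M\<close> but not
    \<open>poly p M\<close>, so the bound for the body is taken at
    \<open>M + poly p M\<close>.\<close>
  define q' where "q' = pcompose q ([:0, 1:] + p)"
  show ?case
  proof (intro exI[of _ "p + 11 + p * (q' + 5)"] allI impI)
    fix s m :: "nat \<Rightarrow> nat" and M
    assume s: "\<forall>x. s x \<le> M" and m: "\<forall>a. m a \<le> M"
    have a: "eval a s m \<le> poly p M" "etime a s m \<le> poly p M"
      using p s m by auto
    have b: "eval b (s(x := i)) m \<le> poly q' M" "etime b (s(x := i)) m + 5 \<le> poly q' M + 5"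
      if "i < eval a s m" for i
    proof -
      have "\<forall>y. (s(x := i)) y \<le> M + poly p M" "\<forall>a. m a \<le> M + poly p M"
        using s m a that by (auto intro: trans_le_add1 simp: trans_le_add2)
      then show "eval b (s(x := i)) m \<le> poly q' M" "etime b (s(x := i)) m + 5 \<le> poly q' M + 5"
        using q by (auto simp: q'_def poly_pcompose)
    qed
    have e: "poly (p + 11 + p * (q' + 5)) M = poly p M + 11 + poly p M * (poly q' M + 5)"
      by simp
    have "eval (Sum x a b) s m \<le> eval a s m * poly q' M"
      using sum_bounded_above[of "{..<eval a s m}", OF b(1)] by simp
    also have "\<dots> \<le> poly p M * (poly q' M + 5)"
      using a by (intro mult_mono) auto
    finally have 1: "eval (Sum x a b) s m \<le> poly (p + 11 + p * (q' + 5)) M"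
      unfolding e by simp
    have "(\<Sum>i<eval a s m. etime b (s(x := i)) m + 5) \<le> eval a s m * (poly q' M + 5)"
      using sum_bounded_above[of "{..<eval a s m}", OF b(2)] by simp
    also have "\<dots> \<le> poly p M * (poly q' M + 5)"
      using a by (intro mult_mono) auto
    finally have "etime (Sum x a b) s m \<le> poly (p + 11 + p * (q' + 5)) M"
      using a unfolding e by simp
    with 1 show "eval (Sum x a b) s m \<le> poly (p + 11 + p * (q' + 5)) M \<and>
        etime (Sum x a b) s m \<le> poly (p + 11 + p * (q' + 5)) M" by blast
  qed
qed

lemma fold_invariant_upt:
  assumes "P m" "\<And>i m. i < n \<Longrightarrow> P m \<Longrightarrow> P (f i m)"
  shows "P (fold f [0..<n] m)"
  using assms by (induction n) auto

lemma sem_le: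
  assumes "1 \<le> M" "\<And>a. m a \<le> M"
  shows "sem c s m a \<le> M"
  using assms
proof (induction c arbitrary: s m a)
  case (For x e c)
  have "\<forall>a. fold (\<lambda>i. sem c (s(x := i))) [0..<eval e s m] m a \<le> M"
    by (rule fold_invariant_upt[where P = "\<lambda>m. \<forall>a. m a \<le> M"]) (use For in auto)
  then show ?case by simp
qed auto

text \<open>All iterations of a loop start from a memory bounded by the same \<open>M\<close>. If an
  iteration could raise this bound, polynomials would have to be composed as often as the loop
  runs.\<close>

lemma com_poly_bound:
  "\<exists>p. \<forall>s m M. 1 \<le> M \<longrightarrow> (\<forall>x. s x \<le> M) \<longrightarrow> (\<forall>a. m a \<le> M) \<longrightarrow> ctime c s m \<le> poly p M"
proof (induction c)
  case (Asg a b)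
  obtain p where "\<forall>s m M. (\<forall>x. s x \<le> M) \<longrightarrow> (\<forall>a. m a \<le> M) \<longrightarrow>
      eval a s m \<le> poly p M \<and> etime a s m \<le> poly p M"
    using exp_poly_bound by blast
  moreover obtain q where "\<forall>s m M. (\<forall>x. s x \<le> M) \<longrightarrow> (\<forall>a. m a \<le> M) \<longrightarrow>
      eval b s m \<le> poly q M \<and> etime b s m \<le> poly q M"
    using exp_poly_bound by blast
  ultimately show ?case
    by (intro exI[of _ "p + q + 8"]) (auto intro: add_mono)
next
  case (Seq c d)
  then obtain p q where
    "\<forall>s m M. 1 \<le> M \<longrightarrow> (\<forall>x. s x \<le> M) \<longrightarrow> (\<forall>a. m a \<le> M) \<longrightarrow> ctime c s m \<le> poly p M"
    "\<forall>s m M. 1 \<le> M \<longrightarrow> (\<forall>x. s x \<le> M) \<longrightarrow> (\<forall>a. m a \<le> M) \<longrightarrow> ctime d s m \<le> poly q M"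
    by blast
  then show ?case
    by (intro exI[of _ "p + q"]) (auto intro!: add_mono simp: sem_le)
next
  case (For x a c)
  obtain p where p: "\<forall>s m M. (\<forall>x. s x \<le> M) \<longrightarrow> (\<forall>a. m a \<le> M) \<longrightarrow>
      eval a s m \<le> poly p M \<and> etime a s m \<le> poly p M"
    using exp_poly_bound by blast
  obtain q where q:
    "\<forall>s m M. 1 \<le> M \<longrightarrow> (\<forall>x. s x \<le> M) \<longrightarrow> (\<forall>a. m a \<le> M) \<longrightarrow> ctime c s m \<le> poly q M"
    using For by blast
  define q' where "q' = pcompose q ([:0, 1:] + p)"
  show ?case
  proof (intro exI[of _ "p + 8 + p * (q' + 4)"] allI impI)
    fix s m :: "nat \<Rightarrow> nat" and M :: nat
    assume M: "1 \<le> M" and s: "\<forall>x. s x \<le> M" and m: "\<forall>a. m a \<le> M"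
    let ?m = "\<lambda>i. fold (\<lambda>i. sem c (s(x := i))) [0..<i] m"
    have a: "eval a s m \<le> poly p M" "etime a s m \<le> poly p M"
      using p s m by auto
    have b: "ctime c (s(x := i)) (?m i) + 4 \<le> poly q' M + 4" if "i < eval a s m" for i
    proof -
      have "\<forall>a. ?m i a \<le> M"
        by (rule fold_invariant_upt[where P = "\<lambda>m. \<forall>a. m a \<le> M"]) (use M m in \<open>auto simp: sem_le\<close>)
      then have "\<forall>y. (s(x := i)) y \<le> M + poly p M" "\<forall>a. ?m i a \<le> M + poly p M"
          "1 \<le> M + poly p M"
        using s m M a that by (auto intro: trans_le_add1 simp: trans_le_add2)
      then show ?thesis
        using q by (auto simp: q'_def poly_pcompose)
    qed
    have "(\<Sum>i<eval a s m. ctime c (s(x := i)) (?m i) + 4) \<le> eval a s m * (poly q' M + 4)"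
      using sum_bounded_above[of "{..<eval a s m}", OF b] by simp
    also have "\<dots> \<le> poly p M * (poly q' M + 4)"
      using a by (intro mult_mono) auto
    finally show "ctime (For x a c) s m \<le> poly (p + 8 + p * (q' + 4)) M"
      using a by simp
  qed
qed

section \<open>Compilation\<close>

text \<open>The registers are split by residues modulo 3 into variables, scratch registers and memory
  cells, so the compiler needs no bound on the number of scratch registers.\<close>

definition vr :: "nat \<Rightarrow> nat" where "vr x = 3 * x"
definition tr :: "nat \<Rightarrow> nat" where "tr d = 3 * d + 1"
definition mr :: "nat \<Rightarrow> nat" where "mr a = 3 * a + 2"

lemma register_simps [simp]:
  "vr x = vr y \<longleftrightarrow> x = y" "tr x = tr y \<longleftrightarrow> x = y" "mr x = mr y \<longleftrightarrow> x = y"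
  "vr x \<noteq> tr y" "vr x \<noteq> mr y" "tr x \<noteq> mr y" "tr x \<noteq> vr y" "mr x \<noteq> vr y" "mr x \<noteq> tr y"
  unfolding vr_def tr_def mr_def by presburger+

abbreviation env :: "(nat \<Rightarrow> nat) \<Rightarrow> nat \<Rightarrow> nat" where "env r \<equiv> \<lambda>x. r (vr x)"
abbreviation mem :: "(nat \<Rightarrow> nat) \<Rightarrow> nat \<Rightarrow> nat" where "mem r \<equiv> \<lambda>a. r (mr a)"

fun code_at :: "instr list \<Rightarrow> nat \<Rightarrow> instr list \<Rightarrow> bool" where
  "code_at P l [] \<longleftrightarrow> True"
| "code_at P l (i # is) \<longleftrightarrow> l < length P \<and> P ! l = i \<and> code_at P (Suc l) is"

lemma code_at_append [simp]:
  "code_at P l (p @ q) \<longleftrightarrow> code_at P l p \<and> code_at P (l + length p) q"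
  by (induction p arbitrary: l) auto

lemma code_at_self: "code_at (p @ q) (length p) q"
proof (induction q arbitrary: p)
  case (Cons i q)
  from Cons[of "p @ [i]"] show ?case by simp
qed simp

text \<open>\<open>tr d\<close> counts the remaining rounds down, \<open>vr x\<close> counts up,
  \<open>tr (d + 1)\<close> saves the outer value of the loop variable, and
  \<open>tr (d + 2)\<close> holds the constant 1. The prelude jumps to the test in the coda, so that
  zero rounds are possible. Registers are copied by adding them to 0.\<close>

definition for_prelude :: "nat \<Rightarrow> nat \<Rightarrow> nat \<Rightarrow> instr list" where
  "for_prelude x d l =
     [Const (tr (d + 1)) 0, Add (tr (d + 1)) (vr x) (tr (d + 1)), Const (vr x) 0,
      Const (tr (d + 2)) 1, Jump_pos (tr (d + 2)) l]"

definition for_coda :: "nat \<Rightarrow> nat \<Rightarrow> nat \<Rightarrow> instr list" where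
  "for_coda x d l =
     [Const (tr (d + 2)) 1, Add (vr x) (vr x) (tr (d + 2)), Sub (tr d) (tr d) (tr (d + 2)),
      Jump_pos (tr d) l, Const (vr x) 0, Add (vr x) (vr x) (tr (d + 1))]"

definition for_code :: "nat \<Rightarrow> nat \<Rightarrow> nat \<Rightarrow> instr list \<Rightarrow> instr list" where
  "for_code x d l b =
     for_prelude x d (l + length b + 8) @ b @ for_coda x d (l + 5)"

lemma length_for_prelude [simp]: "length (for_prelude x d l) = 5"
  by (simp add: for_prelude_def)

lemma length_for_code [simp]: "length (for_code x d l b) = length b + 11"
  by (simp add: for_code_def for_prelude_def for_coda_def)

text \<open>The value goes to \<open>tr d\<close>, while the scratch registers below hold pending
  results; \<open>l\<close> is the absolute address of the code, on which the jump targets depend.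
  \<open>Mem\<close> forms the register number \<open>3 * a + 2\<close> by additions. In
  \<open>Sum\<close>, the loop control occupies \<open>tr d\<close> to \<open>tr (d + 2)\<close> and
  the accumulator is \<open>tr (d + 3)\<close>.\<close>

fun comp_exp :: "exp \<Rightarrow> nat \<Rightarrow> nat \<Rightarrow> instr list" where
  "comp_exp (C c) d l = [Const (tr d) c]"
| "comp_exp (V x) d l = [Const (tr d) 0, Add (tr d) (vr x) (tr d)]"
| "comp_exp (Plus' a b) d l =
     (let p = comp_exp a d l
      in p @ comp_exp b (d + 1) (l + length p) @ [Add (tr d) (tr d) (tr (d + 1))])"
| "comp_exp (Minus' a b) d l =
     (let p = comp_exp a d l
      in p @ comp_exp b (d + 1) (l + length p) @ [Sub (tr d) (tr d) (tr (d + 1))])"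
| "comp_exp (Mem a) d l =
     comp_exp a d l @
     [Add (tr (d + 1)) (tr d) (tr d), Add (tr d) (tr d) (tr (d + 1)), Const (tr (d + 1)) 2,
      Add (tr d) (tr d) (tr (d + 1)), Load (tr d) (tr d)]"
| "comp_exp (Sum x a b) d l =
     (let p = comp_exp a d l @ [Const (tr (d + 3)) 0]
      in p @ for_code x d (l + length p)
               (comp_exp b (d + 4) (l + length p + 5) @
                [Add (tr (d + 3)) (tr (d + 3)) (tr (d + 4))]) @
         [Const (tr d) 0, Add (tr d) (tr d) (tr (d + 3))])"

text \<open>In an assignment, truncated subtraction from 1, done twice, turns the value into a truth
  value.\<close>

fun comp_com :: "com \<Rightarrow> nat \<Rightarrow> nat \<Rightarrow> instr list" where
  "comp_com (Asg a b) d l =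
     (let p = comp_exp a d l
      in p @ comp_exp b (d + 1) (l + length p) @
         [Const (tr (d + 2)) 1, Sub (tr (d + 1)) (tr (d + 2)) (tr (d + 1)),
          Sub (tr (d + 1)) (tr (d + 2)) (tr (d + 1)),
          Add (tr (d + 2)) (tr d) (tr d), Add (tr d) (tr d) (tr (d + 2)), Const (tr (d + 2)) 2,
          Add (tr d) (tr d) (tr (d + 2)), Store (tr d) (tr (d + 1))])"
| "comp_com (Seq c e) d l =
     (let p = comp_com c d l in p @ comp_com e d (l + length p))"
| "comp_com (For x a c) d l =
     (let p = comp_exp a d l
      in p @ for_code x d (l + length p) (comp_com c (d + 3) (l + length p + 5)))"

text \<open>A Hoare-style triple with an exact step count. The unread input \<open>w\<close> is
  arbitrary and comes back unchanged, so such code consumes no input.\<close>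

definition runs :: "instr list \<Rightarrow> nat \<Rightarrow> (nat \<Rightarrow> nat) \<Rightarrow> nat \<Rightarrow> nat \<Rightarrow> ((nat \<Rightarrow> nat) \<Rightarrow> bool) \<Rightarrow> bool" where
  "runs P l r n l' Q \<longleftrightarrow> (\<forall>w. \<exists>r'. steps P (l, r, w) n (l', r', w) \<and> Q r')"

lemma runs_trans:
  assumes "runs P l r m l' Q" "\<And>r'. Q r' \<Longrightarrow> runs P l' r' n l'' Q'"
  shows "runs P l r (m + n) l'' Q'"
  unfolding runs_def
proof
  fix w
  obtain r' where r': "steps P (l, r, w) m (l', r', w)" "Q r'"
    using assms(1) by (auto simp: runs_def)
  obtain r'' where "steps P (l', r', w) n (l'', r'', w)" "Q' r''"
    using assms(2)[OF r'(2)] by (auto simp: runs_def)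
  with r'(1) show "\<exists>r'. steps P (l, r, w) (m + n) (l'', r', w) \<and> Q' r'"
    by (blast intro: steps_trans)
qed

lemma runs_mono: "runs P l r n l' Q \<Longrightarrow> (\<And>r. Q r \<Longrightarrow> Q' r) \<Longrightarrow> runs P l r n l' Q'"
  unfolding runs_def by blast

section \<open>Execution rules for straight-line code, jumps and counting loops\<close>

fun effect :: "instr \<Rightarrow> (nat \<Rightarrow> nat) \<Rightarrow> (nat \<Rightarrow> nat)" where
  "effect (Const i c) r = r(i := c)"
| "effect (Add i j k) r = r(i := r j + r k)"
| "effect (Sub i j k) r = r(i := r j - r k)"
| "effect (Load i j) r = r(i := r (r j))"
| "effect (Store i j) r = r(r i := r j)"
| "effect (Jump_pos i m) r = r"
| "effect (Read i) r = r"

fun straight :: "instr \<Rightarrow> bool" where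
  "straight (Jump_pos i m) \<longleftrightarrow> False"
| "straight (Read i) \<longleftrightarrow> False"
| "straight _ \<longleftrightarrow> True"

lemma steps_straight:
  "code_at P l is \<Longrightarrow> list_all straight is \<Longrightarrow>
   steps P (l, r, w) (length is) (l + length is, fold effect is r, w)"
proof (induction "is" arbitrary: l r)
  case (Cons i "is")
  have "exec i (l, r, w) = (Suc l, effect i r, w)"
    using Cons.prems by (cases i) auto
  then show ?case
    using Cons.IH[of "Suc l" "effect i r"] Cons.prems by (auto intro: steps_step)
qed (auto intro: steps_refl)

lemma runs_straight:
  assumes "code_at P l is" "list_all straight is" "Q (fold effect is r)"
    "n = length is" "l' = l + length is"
  shows "runs P l r n l' Q"
  using steps_straight[OF assms(1,2)] assms(3-) unfolding runs_def by blast

lemma runs_jump: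
  assumes "l < length P" "P ! l = Jump_pos i l'" "0 < r i" "Q r"
  shows "runs P l r 1 l' Q"
  unfolding runs_def using assms
  by (auto intro!: exI[of _ r] steps_step[of l P r _ 0, simplified] steps_refl)

lemma runs_no_jump:
  assumes "l < length P" "P ! l = Jump_pos i l'" "r i = 0" "Q r"
  shows "runs P l r 1 (Suc l) Q"
  unfolding runs_def using assms
  by (auto intro!: exI[of _ r] steps_step[of l P r _ 0, simplified] steps_refl)

text \<open>The invariant \<open>J\<close> is insensitive to the registers of the loop control, so
  prelude and coda cannot destroy it. The body has to keep both counters and the saved value, but
  may overwrite \<open>tr (d + 2)\<close>, which the coda sets to 1 again.\<close>

lemma runs_for:
  assumes code: "code_at P l (for_code x d l b)"
    and bound: "r (tr d) = n"
    and init: "J 0 r"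
    and J_cong: "\<And>i r r'. J i r \<Longrightarrow>
      (\<And>y. y \<notin> {vr x, tr d, tr (d + 1), tr (d + 2)} \<Longrightarrow> r' y = r y) \<Longrightarrow> J i r'"
    and body: "\<And>i r. i < n \<Longrightarrow> J i r \<Longrightarrow> r (vr x) = i \<Longrightarrow>
      runs P (l + 5) r (t i) (l + 5 + length b)
        (\<lambda>r'. J (Suc i) r' \<and> r' (vr x) = i \<and> r' (tr d) = r (tr d) \<and> r' (tr (d + 1)) = r (tr (d + 1)))"
  shows "runs P l r (8 + (\<Sum>i<n. t i + 4)) (l + length b + 11)
           (\<lambda>r'. J n r' \<and> r' (vr x) = r (vr x))"
proof -
  let ?c = "l + length b + 8"
  let ?I = "\<lambda>i r'. J i r' \<and> r' (vr x) = i \<and> r' (tr d) = n - i \<and> r' (tr (d + 1)) = r (vr x)"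
  have code': "code_at P l (for_prelude x d ?c)" "code_at P (l + 5 + length b) (for_coda x d (l + 5))"
    using code by (simp_all add: for_code_def add.commute add.left_commute)
  \<comment> \<open>The invariant is stated at the loop test, after \<open>j\<close> finished rounds
    and with \<open>n - j\<close> left; \<open>j = 0\<close> is the arrival from the
    prelude.\<close>
  have loop: "runs P l r (5 + (\<Sum>i<j. t i + 4)) ?c (?I j)" if "j \<le> n" for j
    using that
  proof (induction j)
    case 0
    have "runs P l r (4 + 1) ?c (?I 0)"
    proof (rule runs_trans)
      show "runs P l r 4 (l + 4) (\<lambda>r'. ?I 0 r' \<and> 0 < r' (tr (d + 2)))"
        using code' bound
        by (intro runs_straight[where ?is = "take 4 (for_prelude x d ?c)"])
          (auto simp: for_prelude_def intro!: J_cong[OF init] split: if_splits)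
    next
      fix r' assume "?I 0 r' \<and> 0 < r' (tr (d + 2))"
      then show "runs P (l + 4) r' 1 ?c (?I 0)"
        using code' by (intro runs_jump) (auto simp: for_prelude_def numeral_eq_Suc)
    qed
    then show ?case by simp
  next
    case (Suc j)
    have "runs P l r ((5 + (\<Sum>i<j. t i + 4)) + (1 + (t j + 3))) ?c (?I (Suc j))"
    proof (rule runs_trans[OF Suc.IH[OF Suc_leD[OF Suc.prems]]], rule runs_trans)
      fix r' assume "?I j r'"
      then show "runs P ?c r' 1 (l + 5) (?I j)"
        using code' Suc.prems
        by (intro runs_jump) (auto simp: for_coda_def numeral_eq_Suc)
    next
      fix r' assume "?I j r'"
      then show "runs P (l + 5) r' (t j + 3) ?c (?I (Suc j))"
      proof (intro runs_trans)
        show "runs P (l + 5) r' (t j) (l + 5 + length b) (\<lambda>r''. J (Suc j) r'' \<and> r'' (vr x) = j \<and>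
            r'' (tr d) = n - j \<and> r'' (tr (d + 1)) = r (vr x))"
          using body[of j r'] Suc.prems \<open>?I j r'\<close> by simp
      next
        fix r'' assume r'': "J (Suc j) r'' \<and> r'' (vr x) = j \<and>
            r'' (tr d) = n - j \<and> r'' (tr (d + 1)) = r (vr x)"
        show "runs P (l + 5 + length b) r'' 3 ?c (?I (Suc j))"
          using code' r''
          by (intro runs_straight[where ?is = "take 3 (for_coda x d (l + 5))"])
            (auto simp: for_coda_def intro!: J_cong[OF conjunct1[OF r'']] split: if_splits)
      qed
    qed
    then show ?case by (simp add: algebra_simps)
  qed
  have "runs P l r ((5 + (\<Sum>i<n. t i + 4)) + (1 + 2)) (l + length b + 11)
           (\<lambda>r'. J n r' \<and> r' (vr x) = r (vr x))"
  proof (rule runs_trans[OF loop[OF order.refl]], rule runs_trans)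
    fix r' assume "?I n r'"
    then show "runs P ?c r' 1 (Suc ?c) (?I n)"
      using code' by (intro runs_no_jump) (auto simp: for_coda_def numeral_eq_Suc)
  next
    fix r' assume r': "?I n r'"
    then show "runs P (Suc ?c) r' 2 (l + length b + 11)
           (\<lambda>r'. J n r' \<and> r' (vr x) = r (vr x))"
      using code'
      by (intro runs_straight[where ?is = "drop 4 (for_coda x d (l + 5))"])
        (auto simp: for_coda_def numeral_eq_Suc intro!: J_cong[OF conjunct1[OF r']])
  qed
  then show ?thesis by (simp add: algebra_simps)
qed

section \<open>Correctness of the compiler\<close>

definition keeps :: "nat \<Rightarrow> (nat \<Rightarrow> nat) \<Rightarrow> (nat \<Rightarrow> nat) \<Rightarrow> bool" where
  "keeps d r r' \<longleftrightarrow> env r' = env r \<and> (\<forall>j<d. r' (tr j) = r (tr j))"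

lemma comp_exp_runs:
  "code_at P l (comp_exp e d l) \<Longrightarrow>
   runs P l r (etime e (env r) (mem r)) (l + length (comp_exp e d l))
     (\<lambda>r'. keeps d r r' \<and> mem r' = mem r \<and> r' (tr d) = eval e (env r) (mem r))"
proof (induction e arbitrary: d l r)
  case (C c)
  then show ?case by (intro runs_straight[where ?is = "comp_exp (C c) d l"]) (auto simp: keeps_def)
next
  case (V x)
  then show ?case by (intro runs_straight[where ?is = "comp_exp (V x) d l"]) (auto simp: keeps_def)
next
  case (Plus' a b)
  let ?p = "comp_exp a d l" let ?q = "comp_exp b (d + 1) (l + length ?p)"
  have "runs P l r (etime a (env r) (mem r) + (etime b (env r) (mem r) + 1))
    (l + length ?p + length ?q + 1)
     (\<lambda>r'. keeps d r r' \<and> mem r' = mem r \<and> r' (tr d) = eval (Plus' a b) (env r) (mem r))"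
  proof (rule runs_trans, rule Plus'.IH(1)[of l d], goal_cases)
    case (2 r')
    show ?case
    proof (rule runs_trans)
      show "runs P (l + length ?p) r' (etime b (env r) (mem r)) (l + length ?p + length ?q)
        (\<lambda>r''. keeps (d + 1) r' r'' \<and> mem r'' = mem r' \<and> r'' (tr (d + 1)) = eval b (env r) (mem r))"
        using Plus'.IH(2)[of "l + length ?p" "d + 1" r'] Plus'.prems 2
        by (auto simp: Let_def keeps_def)
    qed (use Plus'.prems 2 in \<open>intro runs_straight[where ?is = "[Add (tr d) (tr d) (tr (d + 1))]"],
          auto simp: Let_def keeps_def add.assoc\<close>)
  qed (use Plus'.prems in \<open>auto simp: Let_def\<close>)
  then show ?case by (simp add: Let_def add.assoc)
next
  case (Minus' a b)
  let ?p = "comp_exp a d l" let ?q = "comp_exp b (d + 1) (l + length ?p)"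
  have "runs P l r (etime a (env r) (mem r) + (etime b (env r) (mem r) + 1))
    (l + length ?p + length ?q + 1)
     (\<lambda>r'. keeps d r r' \<and> mem r' = mem r \<and> r' (tr d) = eval (Minus' a b) (env r) (mem r))"
  proof (rule runs_trans, rule Minus'.IH(1)[of l d], goal_cases)
    case (2 r')
    show ?case
    proof (rule runs_trans)
      show "runs P (l + length ?p) r' (etime b (env r) (mem r)) (l + length ?p + length ?q)
        (\<lambda>r''. keeps (d + 1) r' r'' \<and> mem r'' = mem r' \<and> r'' (tr (d + 1)) = eval b (env r) (mem r))"
        using Minus'.IH(2)[of "l + length ?p" "d + 1" r'] Minus'.prems 2
        by (auto simp: Let_def keeps_def)
    qed (use Minus'.prems 2 in \<open>intro runs_straight[where ?is = "[Sub (tr d) (tr d) (tr (d + 1))]"],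
          auto simp: Let_def keeps_def add.assoc\<close>)
  qed (use Minus'.prems in \<open>auto simp: Let_def\<close>)
  then show ?case by (simp add: Let_def add.assoc)
next
  case (Mem a)
  let ?p = "comp_exp a d l"
  have mr: "Suc (Suc (y + (y + y))) = mr y" for y
    by (simp add: mr_def)
  have "runs P l r (etime a (env r) (mem r) + 5) (l + length ?p + 5)
     (\<lambda>r'. keeps d r r' \<and> mem r' = mem r \<and> r' (tr d) = eval (Mem a) (env r) (mem r))"
  proof (rule runs_trans, rule Mem.IH[of l d], goal_cases)
    case (2 r')
    have "code_at P (l + length ?p) (drop (length ?p) (comp_exp (Mem a) d l))"
      using Mem.prems by simp
    then show ?case
      by (rule runs_straight) (use 2 in \<open>auto simp: keeps_def mr fun_eq_iff\<close>)
  qed (use Mem.prems in auto)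
  then show ?case by (simp add: add.assoc numeral_eq_Suc)
next
  case (Sum x a b)
  let ?s = "env r" and ?m = "mem r"
  let ?n = "eval a ?s ?m" and ?t = "\<lambda>i. etime b (?s(x := i)) ?m + 1"
  let ?p = "comp_exp a d l"
  let ?l = "l + length ?p + 1"
  let ?b = "comp_exp b (d + 4) (?l + 5)"
  let ?body = "?b @ [Add (tr (d + 3)) (tr (d + 3)) (tr (d + 4))]"
  \<comment> \<open>Inside the loop \<open>x\<close> differs from its outer value, so the invariant
    leaves it out; \<open>runs_for\<close> provides that it is restored at the end.\<close>
  define J where "J = (\<lambda>i r'. (\<forall>y. y \<noteq> x \<longrightarrow> r' (vr y) = r (vr y)) \<and> (\<forall>j<d. r' (tr j) = r (tr j)) \<and>
      mem r' = mem r \<and> r' (tr (d + 3)) = (\<Sum>k<i. eval b (?s(x := k)) ?m))"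
  have code: "code_at P l ?p" "code_at P (l + length ?p) [Const (tr (d + 3)) 0]"
    "code_at P ?l (for_code x d ?l ?body)"
    "code_at P (?l + length ?body + 11) [Const (tr d) 0, Add (tr d) (tr d) (tr (d + 3))]"
    using Sum.prems by (auto simp: Let_def add.commute add.left_commute)
  have body: "runs P (?l + 5) r' (?t i) (?l + 5 + length ?body) (\<lambda>r''. J (Suc i) r'' \<and>
      r'' (vr x) = i \<and> r'' (tr d) = r' (tr d) \<and> r'' (tr (d + 1)) = r' (tr (d + 1)))"
    if "J i r'" "r' (vr x) = i" for i r'
  proof -
    have e: "env r' = ?s(x := i)" "mem r' = ?m"
      using that by (auto simp: J_def)
    have c: "code_at P (?l + 5) ?b"
        "code_at P (?l + 5 + length ?b) [Add (tr (d + 3)) (tr (d + 3)) (tr (d + 4))]"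
      using code(3) by (auto simp: for_code_def add.commute add.left_commute)
    show ?thesis
    proof (rule runs_trans)
      show "runs P (?l + 5) r' (etime b (?s(x := i)) ?m) (?l + 5 + length ?b)
        (\<lambda>r''. keeps (d + 4) r' r'' \<and> mem r'' = mem r' \<and> r'' (tr (d + 4)) = eval b (?s(x := i)) ?m)"
        using Sum.IH(2)[OF c(1), of r'] unfolding e .
    next
      fix r'' assume k: "keeps (d + 4) r' r'' \<and> mem r'' = mem r' \<and>
        r'' (tr (d + 4)) = eval b (?s(x := i)) ?m"
      then have "r'' (vr y) = r' (vr y)" for y
        unfolding keeps_def by metis
      with k show "runs P (?l + 5 + length ?b) r'' 1 (?l + 5 + length ?body) (\<lambda>r''. J (Suc i) r'' \<and>
        r'' (vr x) = i \<and> r'' (tr d) = r' (tr d) \<and> r'' (tr (d + 1)) = r' (tr (d + 1)))"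
        by (intro runs_straight[OF c(2)]) (use that in \<open>auto simp: J_def keeps_def\<close>)
    qed
  qed
  have "runs P l r (etime a ?s ?m + (1 + ((8 + (\<Sum>i<?n. ?t i + 4)) + 2))) (?l + length ?body + 13)
     (\<lambda>r'. keeps d r r' \<and> mem r' = mem r \<and> r' (tr d) = eval (Sum x a b) (env r) (mem r))"
  proof (rule runs_trans[OF Sum.IH(1)[OF code(1)]], rule runs_trans)
    fix r' assume r': "keeps d r r' \<and> mem r' = mem r \<and> r' (tr d) = eval a ?s ?m"
    then have "r' (vr y) = r (vr y)" for y
      unfolding keeps_def by metis
    with r' show "runs P (l + length ?p) r' 1 ?l (\<lambda>r'. J 0 r' \<and> r' (tr d) = ?n \<and> r' (vr x) = r (vr x))"
      by (intro runs_straight[OF code(2)]) (auto simp: J_def keeps_def)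
  next
    fix r' assume r': "J 0 r' \<and> r' (tr d) = ?n \<and> r' (vr x) = r (vr x)"
    show "runs P ?l r' ((8 + (\<Sum>i<?n. ?t i + 4)) + 2) (?l + length ?body + 13)
      (\<lambda>r'. keeps d r r' \<and> mem r' = mem r \<and> r' (tr d) = eval (Sum x a b) (env r) (mem r))"
    proof (rule runs_trans)
      show "runs P ?l r' (8 + (\<Sum>i<?n. ?t i + 4)) (?l + length ?body + 11)
          (\<lambda>r''. J ?n r'' \<and> r'' (vr x) = r' (vr x))"
        proof (rule runs_for[where J = J and t = ?t, OF code(3)])
          show "r' (tr d) = ?n" "J 0 r'"
            using r' by auto
          show "J i r2" if "J i r1"
            "\<And>y. y \<notin> {vr x, tr d, tr (d + 1), tr (d + 2)} \<Longrightarrow> r2 y = r1 y" for i r1 r2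
            using that by (auto simp: J_def)
        qed (rule body)
    next
      fix r'' assume r'': "J ?n r'' \<and> r'' (vr x) = r' (vr x)"
      then have "r'' (vr y) = r (vr y)" for y
        using r' unfolding J_def by metis
      with r'' show "runs P (?l + length ?body + 11) r'' 2 (?l + length ?body + 13)
        (\<lambda>r'. keeps d r r' \<and> mem r' = mem r \<and> r' (tr d) = eval (Sum x a b) (env r) (mem r))"
        by (intro runs_straight[OF code(4)]) (auto simp: J_def keeps_def)
    qed
  qed
  moreover have "etime a ?s ?m + (1 + ((8 + (\<Sum>i<?n. ?t i + 4)) + 2)) = etime (Sum x a b) ?s ?m"
    by (simp add: add.commute)
  moreover have "?l + length ?body + 13 = l + length (comp_exp (Sum x a b) d l)"
    by (simp add: Let_def add.commute add.left_commute)
  ultimately show ?case by (simp only:)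
qed

lemma comp_com_runs:
  "code_at P l (comp_com c d l) \<Longrightarrow>
   runs P l r (ctime c (env r) (mem r)) (l + length (comp_com c d l))
     (\<lambda>r'. keeps d r r' \<and> mem r' = sem c (env r) (mem r))"
proof (induction c arbitrary: d l r)
  case (Asg a b)
  let ?p = "comp_exp a d l" let ?q = "comp_exp b (d + 1) (l + length ?p)"
  have mr: "Suc (Suc (y + (y + y))) = mr y" for y
    by (simp add: mr_def)
  have "runs P l r (etime a (env r) (mem r) + (etime b (env r) (mem r) + 8))
    (l + length ?p + length ?q + 8)
     (\<lambda>r'. keeps d r r' \<and> mem r' = sem (Asg a b) (env r) (mem r))"
  proof (rule runs_trans, rule comp_exp_runs[of P l a d], goal_cases)
    case (2 r')
    show ?case
    proof (rule runs_trans)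
      show "runs P (l + length ?p) r' (etime b (env r) (mem r)) (l + length ?p + length ?q)
        (\<lambda>r''. keeps (d + 1) r' r'' \<and> mem r'' = mem r' \<and> r'' (tr (d + 1)) = eval b (env r) (mem r))"
        using comp_exp_runs[of P "l + length ?p" b "d + 1" r'] Asg.prems 2
        by (auto simp: Let_def keeps_def)
    next
      fix r'' assume r'': "keeps (d + 1) r' r'' \<and> mem r'' = mem r' \<and>
        r'' (tr (d + 1)) = eval b (env r) (mem r)"
      have "code_at P (l + length ?p + length ?q) (drop (length ?p + length ?q) (comp_com (Asg a b) d l))"
        using Asg.prems by (auto simp: Let_def)
      then show "runs P (l + length ?p + length ?q) r'' 8 (l + length ?p + length ?q + 8)
         (\<lambda>r'. keeps d r r' \<and> mem r' = sem (Asg a b) (env r) (mem r))"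
        by (rule runs_straight) (use 2 r'' in \<open>auto simp: Let_def keeps_def mr fun_eq_iff\<close>)
    qed
  qed (use Asg.prems in \<open>auto simp: Let_def\<close>)
  then show ?case by (simp add: Let_def add.assoc numeral_eq_Suc del: sem.simps)
next
  case (Seq c e)
  let ?p = "comp_com c d l"
  have "runs P l r (ctime (Seq c e) (env r) (mem r))
    (l + length ?p + length (comp_com e d (l + length ?p)))
     (\<lambda>r'. keeps d r r' \<and> mem r' = sem (Seq c e) (env r) (mem r))"
    unfolding ctime.simps
  proof (rule runs_trans, rule Seq.IH(1)[of l d], goal_cases)
    case (2 r')
    then show ?case
      using Seq.IH(2)[of "l + length ?p" d r'] Seq.prems
      by (auto simp: Let_def keeps_def elim: runs_mono)
  qed (use Seq.prems in \<open>auto simp: Let_def\<close>)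
  then show ?case by (simp add: Let_def add.assoc)
next
  case (For x a c)
  let ?s = "env r" and ?m = "\<lambda>i. fold (\<lambda>i. sem c ((env r)(x := i))) [0..<i] (mem r)"
  let ?n = "eval a ?s (mem r)" and ?t = "\<lambda>i. ctime c (?s(x := i)) (?m i)"
  let ?p = "comp_exp a d l"
  let ?l = "l + length ?p"
  let ?b = "comp_com c (d + 3) (?l + 5)"
  define J where "J = (\<lambda>i r'. (\<forall>y. y \<noteq> x \<longrightarrow> r' (vr y) = r (vr y)) \<and> (\<forall>j<d. r' (tr j) = r (tr j)) \<and>
      mem r' = ?m i)"
  have code: "code_at P l ?p" "code_at P ?l (for_code x d ?l ?b)"
    using For.prems by (auto simp: Let_def add.commute add.left_commute)
  have body: "runs P (?l + 5) r' (?t i) (?l + 5 + length ?b) (\<lambda>r''. J (Suc i) r'' \<and>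
      r'' (vr x) = i \<and> r'' (tr d) = r' (tr d) \<and> r'' (tr (d + 1)) = r' (tr (d + 1)))"
    if "J i r'" "r' (vr x) = i" for i r'
  proof -
    have e: "env r' = ?s(x := i)" "mem r' = ?m i"
      using that by (auto simp: J_def)
    have c: "code_at P (?l + 5) ?b"
      using code(2) by (auto simp: for_code_def add.commute add.left_commute)
    show ?thesis
    proof (rule runs_mono)
      show "runs P (?l + 5) r' (?t i) (?l + 5 + length ?b)
        (\<lambda>r''. keeps (d + 3) r' r'' \<and> mem r'' = ?m (Suc i))"
        using For.IH[OF c, of r'] unfolding e by simp
    next
      fix r'' assume k: "keeps (d + 3) r' r'' \<and> mem r'' = ?m (Suc i)"
      then have "r'' (vr y) = r' (vr y)" for y
        unfolding keeps_def by metis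
      with k that show "J (Suc i) r'' \<and>
        r'' (vr x) = i \<and> r'' (tr d) = r' (tr d) \<and> r'' (tr (d + 1)) = r' (tr (d + 1))"
        by (auto simp: J_def keeps_def)
    qed
  qed
  have "runs P l r (etime a ?s (mem r) + (8 + (\<Sum>i<?n. ?t i + 4))) (?l + length ?b + 11)
     (\<lambda>r'. keeps d r r' \<and> mem r' = sem (For x a c) (env r) (mem r))"
  proof (rule runs_trans[OF comp_exp_runs[OF code(1)]])
    fix r' assume r': "keeps d r r' \<and> mem r' = mem r \<and> r' (tr d) = ?n"
    then have v: "r' (vr y) = r (vr y)" for y
      unfolding keeps_def by metis
    show "runs P ?l r' (8 + (\<Sum>i<?n. ?t i + 4)) (?l + length ?b + 11)
      (\<lambda>r'. keeps d r r' \<and> mem r' = sem (For x a c) (env r) (mem r))"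
    proof (rule runs_mono)
      show "runs P ?l r' (8 + (\<Sum>i<?n. ?t i + 4)) (?l + length ?b + 11)
          (\<lambda>r''. J ?n r'' \<and> r'' (vr x) = r' (vr x))"
        proof (rule runs_for[where J = J and t = ?t, OF code(2)])
          show "r' (tr d) = ?n" "J 0 r'"
            using r' v by (auto simp: J_def keeps_def)
          show "J i r2" if "J i r1"
            "\<And>y. y \<notin> {vr x, tr d, tr (d + 1), tr (d + 2)} \<Longrightarrow> r2 y = r1 y" for i r1 r2
            using that by (auto simp: J_def)
        qed (rule body)
    next
      fix r'' assume r'': "J ?n r'' \<and> r'' (vr x) = r' (vr x)"
      then have "r'' (vr y) = r (vr y)" for y
        using v unfolding J_def by metis
      with r'' show "keeps d r r'' \<and> mem r'' = sem (For x a c) (env r) (mem r)"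
        by (auto simp: J_def keeps_def)
    qed
  qed
  then show ?case by (simp add: Let_def add.assoc)
qed

section \<open>Programs with bounded loops run in polynomial time\<close>

text \<open>The length of the input is stored in variable 1; the scratch registers 0 to 5 hold 1, 2, 3,
  the address of the next free memory cell, the last value read and 2 minus that value.\<close>

definition read_code :: "instr list" where
  "read_code =
     [Const (tr 0) 1, Const (tr 1) 2, Const (tr 2) 3, Const (tr 3) 2, Jump_pos (tr 0) 8,
      Store (tr 3) (tr 4), Add (tr 3) (tr 3) (tr 2), Add (vr 1) (vr 1) (tr 0),
      Read (tr 4), Sub (tr 5) (tr 1) (tr 4), Jump_pos (tr 5) 5]"

definition input_mem :: "bool list \<Rightarrow> nat \<Rightarrow> nat" where
  "input_mem w a = of_bool (a < length w \<and> w ! a)"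

lemma mr_0: "mr 0 = 2"
  by (simp add: mr_def)

lemma mr_Suc: "mr (Suc a) = mr a + 3"
  by (simp add: mr_def)

lemma steps_refl': "c = c' \<Longrightarrow> steps P c 0 c'"
  by (simp add: steps_refl)

lemma steps_Suc:
  "l < length P \<Longrightarrow> P ! l = i \<Longrightarrow> exec i (l, r, w) = c' \<Longrightarrow> steps P c' n c \<Longrightarrow>
   steps P (l, r, w) (Suc n) c"
  by (auto intro: steps_step)

text \<open>\<open>u\<close> is the part already read. Each bit takes six instructions from address
  8 back to 8. At the end of the input the value 2 makes \<open>2 - 2\<close> zero, and the third
  instruction, the jump, falls through.\<close>

lemma read_loop:
  assumes "code_at P 0 read_code"
    and "r (tr 0) = 1" "r (tr 1) = 2" "r (tr 2) = 3" "r (tr 3) = mr (length u)"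
    and "env r = (\<lambda>_. 0)(1 := length u)" "mem r = input_mem u"
  shows "\<exists>r'. steps P (8, r, w) (6 * length w + 3) (11, r', []) \<and>
    env r' = (\<lambda>_. 0)(1 := length (u @ w)) \<and> mem r' = input_mem (u @ w)"
proof -
  have P: "P ! 5 = Store (tr 3) (tr 4)" "P ! 6 = Add (tr 3) (tr 3) (tr 2)"
    "P ! 7 = Add (vr 1) (vr 1) (tr 0)" "P ! 8 = Read (tr 4)" "P ! 9 = Sub (tr 5) (tr 1) (tr 4)"
    "P ! 10 = Jump_pos (tr 5) 5" "10 < length P"
    using assms(1) by (auto simp: read_code_def numeral_eq_Suc)
  show ?thesis
    using assms(2-)
  proof (induction w arbitrary: r u)
    case Nil
    let ?r = "r(tr 4 := 2, tr 5 := 0)"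
    have "steps P (8, r, []) 3 (11, ?r, [])"
      unfolding numeral_3_eq_3
      apply (rule steps_Suc[OF _ P(4)], use P in simp, simp)
      apply (rule steps_Suc[OF _ P(5)], use P in simp, simp)
      apply (rule steps_Suc[OF _ P(6)], use P in simp, simp)
      apply (use Nil in \<open>simp add: steps_refl\<close>)
      done
    moreover have "env ?r = env r" "mem ?r = mem r" by auto
    ultimately show ?case
        using Nil(5,6)
        by (auto simp only: list.size append_Nil2 mult_0_right add_0 intro!: exI[of _ ?r])
  next
    case (Cons b w)
    let ?x = "of_bool b :: nat"
    let ?r = "r(tr 4 := ?x, tr 5 := 2 - ?x, mr (length u) := ?x, tr 3 := mr (length (u @ [b])),
      vr 1 := length (u @ [b]))"
    have r1: "r (vr 1) = length u"
      using Cons.prems(5) by (simp add: fun_eq_iff)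
    have b2: "?x < 2"
      by (cases b) auto
    have st: "steps P (8, r, b # w) (Suc (Suc (Suc (Suc (Suc (Suc 0)))))) (8, ?r, w)"
      apply (rule steps_Suc[OF _ P(4)], use P in simp, simp)
      apply (rule steps_Suc[OF _ P(5)], use P in simp, simp)
      apply (rule steps_Suc[OF _ P(6)], use P in simp, use Cons.prems b2 in simp)
      apply (rule steps_Suc[OF _ P(1)], use P in simp, simp)
      apply (rule steps_Suc[OF _ P(2)], use P in simp, simp)
      apply (rule steps_Suc[OF _ P(3)], use P in simp, simp)
      apply (rule steps_refl')
      using Cons.prems(1-4) r1 apply (cases b; auto simp: fun_eq_iff mr_Suc)
      done
    have "\<exists>r'. steps P (8, ?r, w) (6 * length w + 3) (11, r', []) \<and>
      env r' = (\<lambda>_. 0)(1 := length ((u @ [b]) @ w)) \<and> mem r' = input_mem ((u @ [b]) @ w)"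
    proof (rule Cons.IH)
      show "env ?r = (\<lambda>_. 0)(1 := length (u @ [b]))"
        using Cons.prems(5) by (auto simp: fun_eq_iff)
      show "mem ?r = input_mem (u @ [b])"
        using Cons.prems(6) by (auto simp: fun_eq_iff input_mem_def nth_append less_Suc_eq)
    qed (use Cons.prems in auto)
    then obtain r' where r': "steps P (8, ?r, w) (6 * length w + 3) (11, r', [])"
      "env r' = (\<lambda>_. 0)(1 := length ((u @ [b]) @ w))" "mem r' = input_mem ((u @ [b]) @ w)"
      by blast
    have n: "(Suc (Suc (Suc (Suc (Suc (Suc 0)))))) + (6 * length w + 3) = 6 * length (b # w) + 3"
      by simp
    have w: "(u @ [b]) @ w = u @ b # w"
      by simp
    show ?case
      using steps_trans[OF st r'(1)] r'(2,3) unfolding n w by blast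
  qed
qed

lemma read_code_steps:
  assumes "code_at P 0 read_code"
  shows "\<exists>r. steps P (0, \<lambda>_. 0, w) (6 * length w + 8) (11, r, []) \<and>
    env r = (\<lambda>_. 0)(1 := length w) \<and> mem r = input_mem w"
proof -
  let ?r = "(\<lambda>_. 0)(tr 0 := 1, tr 1 := 2, tr 2 := 3, tr 3 := 2)"
  have P: "P ! 0 = Const (tr 0) 1" "P ! 1 = Const (tr 1) 2" "P ! 2 = Const (tr 2) 3"
    "P ! 3 = Const (tr 3) 2" "P ! Suc (Suc (Suc (Suc 0))) = Jump_pos (tr 0) 8" "4 < length P"
    using assms by (auto simp: read_code_def numeral_eq_Suc)
  have st: "steps P (0, \<lambda>_. 0, w) (Suc (Suc (Suc (Suc (Suc 0))))) (8, ?r, w)"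
    apply (rule steps_Suc[OF _ P(1)], use P in linarith, simp)
    apply (rule steps_Suc[OF _ P(2)[unfolded One_nat_def]], use P in linarith, simp)
    apply (rule steps_Suc[OF _ P(3)[unfolded numeral_2_eq_2]], use P in linarith, simp)
    apply (rule steps_Suc[OF _ P(4)[unfolded numeral_3_eq_3]], use P in linarith, simp)
    apply (rule steps_Suc[OF _ P(5)], use P in linarith, simp)
    apply (rule steps_refl', simp add: numeral_2_eq_2 numeral_3_eq_3)
    done
  have "\<exists>r'. steps P (8, ?r, w) (6 * length w + 3) (11, r', []) \<and>
    env r' = (\<lambda>_. 0)(1 := length ([] @ w)) \<and> mem r' = input_mem ([] @ w)"
    by (rule read_loop[OF assms]) (auto simp: input_mem_def mr_0 fun_eq_iff)
  then obtain r where r: "steps P (8, ?r, w) (6 * length w + 3) (11, r, [])"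
    "env r = (\<lambda>_. 0)(1 := length w)" "mem r = input_mem w"
    unfolding append_Nil by blast
  have n: "(Suc (Suc (Suc (Suc (Suc 0))))) + (6 * length w + 3) = 6 * length w + 8"
    by simp
  show ?thesis
    using steps_trans[OF st r(1)] r(2,3) unfolding n by blast
qed

theorem poly_time_solvable_on_bounded_loops:
  assumes "\<And>x. x \<in> A \<Longrightarrow>
    sem c ((\<lambda>_. 0)(1 := length (enc x))) (input_mem (enc x)) 0 = of_bool (Q x)"
  shows "poly_time_solvable_on A enc Q"
proof -
  \<comment> \<open>The last two instructions copy memory cell 0, which is register 2, to
    \<open>vr 0\<close>, which is register 0, where the answer is expected. The command starts at
    11, the length of \<open>read_code\<close>.\<close>
  define P where
    "P = (read_code @ comp_com c 0 11) @ [Const (vr 0) 0, Add (vr 0) (mr 0) (vr 0)]"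
  obtain p where p: "\<And>s m M. 1 \<le> M \<Longrightarrow> \<forall>x. s x \<le> M \<Longrightarrow> \<forall>a. m a \<le> M \<Longrightarrow> ctime c s m \<le> poly p M"
    using com_poly_bound[of c] by blast
  \<comment> \<open>Every constant of the program is below \<open>b\<close> and hence below
    \<open>2 ^ b\<close>; the summand 2 ensures \<open>2 \<le> b\<close>.\<close>
  define b where "b = Max (insert 0 (literal_const ` set P)) + 2"
  have lit: "literal_const i < 2 ^ b" if "i \<in> set P" for i
  proof -
    have "literal_const i \<le> Max (insert 0 (literal_const ` set P))"
      using that by (intro Max_ge) auto
    also have "\<dots> < b" unfolding b_def by linarith
    also have "b < 2 ^ b" by (rule less_exp)
    finally show ?thesis .
  qed
  \<comment> \<open>On inputs of length \<open>n\<close>, reading takes \<open>6 * n + 8\<close>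
    instructions and the final copy 2. The bound \<open>p\<close> is taken at \<open>n + 1\<close>,
    which is positive and bounds the variables and the memory; \<open>t\<close> then has the shape
    of the bound in \<open>steps_run\<close>.\<close>
  define q where "q = [:10, 6:] + pcompose p [:1, 1:]"
  define t where "t = q * (2 * ([:b:] + q))"
  have "\<exists>n \<le> poly t (length (enc x)). answers_in_time P (enc x) n (Q x)" if "x \<in> A" for x
  proof -
    let ?w = "enc x" let ?s = "(\<lambda>_. 0)(1 := length ?w)" and ?m = "input_mem ?w"
    let ?l = "11 + length (comp_com c 0 11)"
    have l: "length read_code = 11" by (simp add: read_code_def)
    have code: "code_at P 0 read_code" "code_at P 11 (comp_com c 0 11)"
      "code_at P ?l [Const (vr 0) 0, Add (vr 0) (mr 0) (vr 0)]"
      using code_at_self[of "[]" P] by (simp_all add: P_def l)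
    obtain r where r: "steps P (0, \<lambda>_. 0, ?w) (6 * length ?w + 8) (11, r, [])"
      "env r = ?s" "mem r = ?m"
      using read_code_steps[OF code(1)] by blast
    obtain r' where r': "steps P (11, r, []) (ctime c ?s ?m) (?l, r', [])" "mem r' = sem c ?s ?m"
      using comp_com_runs[OF code(2), of r] unfolding runs_def r(2,3) by blast
    let ?r = "r'(vr 0 := mem r' 0)"
    have "runs P ?l r' 2 (?l + 2) (\<lambda>r. r = ?r)"
      by (rule runs_straight[OF code(3)]) (auto simp: fun_eq_iff)
    then have r'': "steps P (?l, r', []) 2 (?l + 2, ?r, [])"
      by (auto simp: runs_def)
    let ?n = "6 * length ?w + 8 + ctime c ?s ?m + 2"
    have st: "steps P (0, \<lambda>_. 0, ?w) ?n (?l + 2, ?r, [])"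
      by (rule steps_trans steps_trans[OF r(1)] r'(1) r'')+
    then obtain n where n: "n \<le> ?n * (2 * (b + ?n))" "run P (0, \<lambda>_. 0, ?w) n (?l + 2, ?r, [])"
      using steps_run[OF st _ _ lit] by (auto simp: b_def)
    have "ctime c ?s ?m \<le> poly p (1 + length ?w)"
      by (rule p) (auto simp: input_mem_def)
    then have "?n \<le> poly q (length ?w)"
      by (simp add: q_def poly_pcompose)
    then have "?n * (2 * (b + ?n)) \<le> poly t (length ?w)"
      unfolding t_def poly_mult poly_add by (intro mult_mono add_mono) auto
    with n(1) have "n \<le> poly t (length ?w)" by (rule le_trans)
    moreover have "?r 0 = of_bool (Q x)"
      using assms[OF that] r'(2) by (simp add: vr_def fun_eq_iff)
    moreover have "length P = ?l + 2" by (simp add: P_def l)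
    ultimately show ?thesis
      using n(2) unfolding answers_in_time_def by (metis order.refl)
  qed
  then show ?thesis unfolding poly_time_solvable_on_def by blast
qed

section \<open>Transitive closure\<close>

definition warshall_step :: "nat \<Rightarrow> nat \<Rightarrow> nat \<Rightarrow> (nat \<times> nat) set \<Rightarrow> (nat \<times> nat) set" where
  "warshall_step k x y S = (if (x, k) \<in> S \<and> (k, y) \<in> S then insert (x, y) S else S)"

text \<open>Row and column \<open>k\<close> do not change in round \<open>k\<close>, so updating in place does no harm.\<close>

lemma warshall_row:
  assumes "S \<subseteq> T" "T \<subseteq> S \<union> {(x, y). (x, k) \<in> S \<and> (k, y) \<in> S}"
  shows "fold (warshall_step k x) [0..<n] T = T \<union> {(x, y) |y. y < n \<and> (x, k) \<in> S \<and> (k, y) \<in> S}"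
proof (induction n)
  case (Suc n)
  let ?T = "T \<union> {(x, y) |y. y < n \<and> (x, k) \<in> S \<and> (k, y) \<in> S}"
  have "(x, k) \<in> ?T \<longleftrightarrow> (x, k) \<in> S" "(k, n) \<in> ?T \<longleftrightarrow> (k, n) \<in> S"
    using assms by blast+
  then have "warshall_step k x n ?T = T \<union> {(x, y) |y. y < Suc n \<and> (x, k) \<in> S \<and> (k, y) \<in> S}"
    by (auto simp: warshall_step_def less_Suc_eq)
  with Suc show ?case by simp
qed simp

lemma warshall_round:
  "fold (\<lambda>x. fold (warshall_step k x) [0..<n]) [0..<l] S =
   S \<union> {(x, y). x < l \<and> y < n \<and> (x, k) \<in> S \<and> (k, y) \<in> S}"
proof (induction l)
  case (Suc l)
  then show ?case
    by (simp, subst warshall_row[of S]) (auto simp: less_Suc_eq)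
qed simp

text \<open>After \<open>l\<close> rounds the relation is closed under composition through points
  below \<open>l\<close>. For \<open>l = n\<close> these are all points that occur, so the relation
  is transitive.\<close>

lemma warshall_trancl:
  assumes "S \<subseteq> {..<n} \<times> {..<n}"
  shows "fold (\<lambda>k. fold (\<lambda>x. fold (warshall_step k x) [0..<n]) [0..<n]) [0..<n] S = S\<^sup>+"
proof -
  let ?W = "\<lambda>l. fold (\<lambda>k. fold (\<lambda>x. fold (warshall_step k x) [0..<n]) [0..<n]) [0..<l] S"
  have "S \<subseteq> ?W l \<and> ?W l \<subseteq> S\<^sup>+ \<and> ?W l \<subseteq> {..<n} \<times> {..<n} \<and>
      (\<forall>z<l. \<forall>x y. (x, z) \<in> ?W l \<longrightarrow> (z, y) \<in> ?W l \<longrightarrow> (x, y) \<in> ?W l)" for l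
  proof (induction l)
    case (Suc l)
    let ?R = "?W l"
    have e: "?W (Suc l) = ?R \<union> {(x, y). x < n \<and> y < n \<and> (x, l) \<in> ?R \<and> (l, y) \<in> ?R}"
      by (simp add: warshall_round)
    obtain R where R: "R = ?R" by blast
    have e': "?W (Suc l) = R \<union> {(x, y). (x, l) \<in> R \<and> (l, y) \<in> R}"
      unfolding e R using Suc by blast
    from Suc show ?case
      unfolding e' R[symmetric] by (auto simp: less_Suc_eq intro: trancl_trans)
  qed (use assms in auto)
  from this[of n] show ?thesis
  proof (elim conjE, intro equalityI)
    assume a: "S \<subseteq> ?W n" "?W n \<subseteq> {..<n} \<times> {..<n}"
      "\<forall>z<n. \<forall>x y. (x, z) \<in> ?W n \<longrightarrow> (z, y) \<in> ?W n \<longrightarrow> (x, y) \<in> ?W n"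
    then have "trans (?W n)" by (intro transI) blast
    then show "S\<^sup>+ \<subseteq> ?W n"
      using trancl_mono[OF _ a(1)] trancl_id by blast
  qed
qed

section \<open>Satisfiability of implications between literals\<close>

text \<open>Take a maximal set of literals that is closed under \<open>R\<close> and free of
  complementary pairs. If it left \<open>x\<close> undecided, one of \<open>x\<close> and
  \<open>neg x\<close>, say \<open>z\<close>, would not imply its own negation, and adding
  \<open>z\<close> with all its consequences would give a larger such set.\<close>

lemma implications_satisfiable:
  assumes "finite L" and neg: "\<And>x. x \<in> L \<Longrightarrow> neg x \<in> L \<and> neg (neg x) = x"
    and "R \<subseteq> L \<times> L" "trans R"
    and contra: "\<And>x y. (x, y) \<in> R \<Longrightarrow> (neg y, neg x) \<in> R"
    and acyclic: "\<And>x. x \<in> L \<Longrightarrow> \<not> ((x, neg x) \<in> R \<and> (neg x, x) \<in> R)"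
    and neq: "\<And>x. x \<in> L \<Longrightarrow> neg x \<noteq> x"
  shows "\<exists>T. (\<forall>x\<in>L. neg x \<in> T \<longleftrightarrow> x \<notin> T) \<and> (\<forall>(x, y)\<in>R. x \<in> T \<longrightarrow> y \<in> T)"
proof -
  define good where
    "good = (\<lambda>T. T \<subseteq> L \<and> (\<forall>x\<in>T. neg x \<notin> T) \<and> (\<forall>(x, y)\<in>R. x \<in> T \<longrightarrow> y \<in> T))"
  have "finite {T. good T}"
    by (rule finite_subset[of _ "Pow L"]) (use assms(1) in \<open>auto simp: good_def\<close>)
  moreover have "{} \<in> {T. good T}" by (simp add: good_def)
  ultimately obtain T where T: "good T" and max: "\<And>T'. good T' \<Longrightarrow> T \<subseteq> T' \<Longrightarrow> T' = T"
    using finite_has_maximal[of "{T. good T}"] by blast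
  have "x \<in> T \<or> neg x \<in> T" if "x \<in> L" for x
  proof (rule ccontr)
    assume no: "\<not> (x \<in> T \<or> neg x \<in> T)"
    have "\<exists>z\<in>L. z \<notin> T \<and> neg z \<notin> T \<and> (z, neg z) \<notin> R"
    proof (cases "(x, neg x) \<in> R")
      case True
      then show ?thesis
        using no acyclic[OF that] neg[OF that] by (intro bexI[of _ "neg x"]) auto
    qed (use no that in blast)
    then obtain z where z: "z \<in> L" "z \<notin> T" "neg z \<notin> T" "(z, neg z) \<notin> R" by blast
    define Z where "Z = insert z {y. (z, y) \<in> R}"
    have ZL: "Z \<subseteq> L" using z assms(3) by (auto simp: Z_def)
    \<comment> \<open>If \<open>z\<close> implied both \<open>y\<close> and \<open>neg y\<close>,
      then by contraposition of the latter \<open>y\<close> would imply \<open>neg z\<close>, and so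
      would \<open>z\<close>.\<close>
    have consistent: "neg y \<notin> Z" if y: "y \<in> Z" for y
    proof
      assume ny: "neg y \<in> Z"
      have yL: "y \<in> L" using y ZL by blast
      have "(z, neg z) \<in> R"
      proof (cases "y = z")
        case True
        then show ?thesis using ny neq[OF z(1)] by (auto simp: Z_def)
      next
        case False
        then have zy: "(z, y) \<in> R" using y by (simp add: Z_def)
        show ?thesis
        proof (cases "neg y = z")
          case True
          then show ?thesis using zy neg[OF yL] by metis
        next
          case False
          then have "(z, neg y) \<in> R" using ny by (simp add: Z_def)
          from contra[OF this] have "(y, neg z) \<in> R" using neg[OF yL] by simp
          with zy show ?thesis using \<open>trans R\<close> by (meson transD)
        qed
      qed
      with z(4) show False by blast
    qed
    \<comment> \<open>By contraposition \<open>neg y\<close> implies \<open>neg z\<close>, which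
      would put \<open>neg z\<close> into the closed set \<open>T\<close>.\<close>
    have apart: "neg y \<notin> T" if y: "y \<in> Z" for y
    proof
      assume ny: "neg y \<in> T"
      with z(3) have "y \<noteq> z" by blast
      then have "(z, y) \<in> R" using y by (simp add: Z_def)
      from contra[OF this] have "neg z \<in> T" using T ny by (auto simp: good_def)
      with z(3) show False by blast
    qed
    have "good (T \<union> Z)"
      unfolding good_def
    proof (intro conjI)
      show "T \<union> Z \<subseteq> L" using T ZL by (auto simp: good_def)
      show "\<forall>x\<in>T \<union> Z. neg x \<notin> T \<union> Z"
      proof (intro ballI notI)
        fix u assume u: "u \<in> T \<union> Z" "neg u \<in> T \<union> Z"
        then have "u \<in> L" using T ZL by (auto simp: good_def)
        then have "neg (neg u) = u" using neg by blast
        then show False using u consistent apart T unfolding good_def by (metis UnE)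
      qed
      show "\<forall>(x, y)\<in>R. x \<in> T \<union> Z \<longrightarrow> y \<in> T \<union> Z"
        using T \<open>trans R\<close> by (auto simp: good_def Z_def dest: transD)
    qed
    from max[OF this] z(2) show False by (auto simp: Z_def)
  qed
  then have "\<forall>x\<in>L. neg x \<in> T \<longleftrightarrow> x \<notin> T"
    using T by (auto simp: good_def)
  then show ?thesis using T by (auto simp: good_def)
qed

section \<open>Reduction to conflicts between colors of \<open>U\<close>\<close>

text \<open>Colors are counted from 0 here.\<close>

definition bad :: "ecbgc \<Rightarrow> nat \<Rightarrow> nat \<Rightarrow> nat \<Rightarrow> nat \<Rightarrow> bool" where
  "bad I i j k s \<longleftrightarrow> (i, j) \<in> edges I \<and> pc I i j (Suc k) (Suc s) \<noteq> Plus"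

text \<open>In the second case \<open>k'\<close> is allowed wherever \<open>k\<close> is, so it can
  replace \<open>k\<close>.\<close>

definition redundant :: "ecbgc \<Rightarrow> nat \<Rightarrow> nat \<Rightarrow> bool" where
  "redundant I j k \<longleftrightarrow> (\<exists>i<nU I. bad I i j k 0 \<and> bad I i j k 1) \<or>
     (\<exists>k'<3. k' \<noteq> k \<and> (\<forall>i<nU I. \<forall>s<2. bad I i j k' s \<longrightarrow> bad I i j k s))"

text \<open>The colors 0, 1, 2 sum to 3, so \<open>3 - k - k'\<close> is the third color. It is
  given up, and the two vertices of \<open>U\<close> block the other two. With \<open>i = i'\<close>
  and \<open>s = s'\<close> this rules out the color \<open>s\<close> at \<open>i\<close>, as a unit
  clause does.\<close>

definition conflict :: "ecbgc \<Rightarrow> nat \<Rightarrow> nat \<Rightarrow> nat \<Rightarrow> nat \<Rightarrow> bool" where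
  "conflict I i s i' s' \<longleftrightarrow> (\<exists>j<nV I. \<exists>k<3. \<exists>k'<3. k \<noteq> k' \<and> redundant I j (3 - k - k') \<and>
     bad I i j k s \<and> bad I i' j k' s')"

lemma conflict_sym: "conflict I i s i' s' \<Longrightarrow> conflict I i' s' i s"
  unfolding conflict_def by (subst (asm) diff_commute) blast

lemma less_2_iff: "s < 2 \<longleftrightarrow> s = 0 \<or> s = 1" for s :: nat
  by auto

lemma less_3_iff: "k < 3 \<longleftrightarrow> k = 0 \<or> k = 1 \<or> k = 2" for k :: nat
  by auto

text \<open>Suppose no edge excludes \<open>b\<close> outright. If \<open>b\<close> is forbidden
  with color \<open>s\<close> of \<open>i\<close>, it is allowed with the other color
  \<open>t\<close>. The side of the equivalence containing \<open>b\<close> with \<open>s\<close> is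
  false, so the side joining \<open>b\<close> with \<open>t\<close> and \<open>a\<close> with
  \<open>s\<close> is false too. Hence \<open>a\<close> is forbidden with \<open>s\<close>, and
  \<open>b\<close> dominates \<open>a\<close>.\<close>

lemma ex_redundant:
  assumes "a \<in> {1, 2, 3}" "b \<in> {1, 2, 3}" "a \<noteq> b"
    and "\<forall>i \<in> {..<nU I}. (i, j) \<in> edges I \<longrightarrow>
      (pc I i j a 1 = Plus \<and> pc I i j b 2 = Plus \<longleftrightarrow> pc I i j a 2 = Plus \<and> pc I i j b 1 = Plus)"
  shows "\<exists>k<3. redundant I j k"
proof -
  obtain k k' where k: "a = Suc k" "b = Suc k'" "k < 3" "k' < 3" "k \<noteq> k'"
    using assms(1-3) by (cases a; cases b) auto
  show ?thesis
  proof (cases "redundant I j k \<or> redundant I j k'")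
    case False
    have "bad I i j k s" if "i < nU I" "s < 2" "bad I i j k' s" for i s
    proof -
      have "\<not> (bad I i j k 0 \<and> bad I i j k 1)" "\<not> (bad I i j k' 0 \<and> bad I i j k' 1)"
        using False that(1) by (auto simp: redundant_def)
      moreover have "s = 0 \<or> s = 1"
        using that(2) by auto
      ultimately show ?thesis
        using assms(4)[rule_format, of i] that(1,3) k(1,2)
        by (elim disjE) (auto simp: bad_def numeral_2_eq_2)
    qed
    then have "redundant I j k"
      using k by (auto simp: redundant_def)
    with k show ?thesis by blast
  qed (use k in blast)
qed

text \<open>Once \<open>U\<close> is colored, the vertices of \<open>V\<close> can be treated
  independently, so the coloring of \<open>V\<close> becomes one existential quantifier per
  vertex.\<close>

lemma ecbgc_colorable_iff:
  assumes "ecbgc_instance I"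
  shows "ecbgc_colorable I \<longleftrightarrow>
    (\<exists>f. (\<forall>i<nU I. f i < 2) \<and> (\<forall>j<nV I. \<exists>k<3. \<forall>i<nU I. \<not> bad I i j k (f i)))"
    (is "_ \<longleftrightarrow> ?R")
proof
  assume "ecbgc_colorable I"
  then obtain f g where f: "f \<in> {..<nU I} \<rightarrow> {1, 2}" and g: "g \<in> {..<nV I} \<rightarrow> {1, 2, 3}"
    and fg: "\<forall>(i, j) \<in> edges I. pc I i j (g j) (f i) = Plus"
    by (auto simp: ecbgc_colorable_def)
  show ?R
  proof (intro exI[of _ "\<lambda>i. f i - 1"] conjI allI impI)
    fix i assume "i < nU I"
    then have "f i \<in> {1, 2}" using f by auto
    then show "f i - 1 < 2" by auto
  next
    fix j assume j: "j < nV I"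
    show "\<exists>k<3. \<forall>i<nU I. \<not> bad I i j k (f i - 1)"
    proof (intro exI[of _ "g j - 1"] conjI allI impI)
      have "g j \<in> {1, 2, 3}" using g j by auto
      then show "g j - 1 < 3" by auto
      fix i assume "i < nU I"
      then have "f i \<in> {1, 2}" using f by auto
      with \<open>g j \<in> {1, 2, 3}\<close> have e: "Suc (g j - 1) = g j" "Suc (f i - 1) = f i"
        by auto
      show "\<not> bad I i j (g j - 1) (f i - 1)"
        unfolding bad_def e using fg by blast
    qed
  qed
next
  assume ?R
  then obtain f g where f: "\<forall>i<nU I. f i < 2"
    and g: "\<forall>j<nV I. g j < 3 \<and> (\<forall>i<nU I. \<not> bad I i j (g j) (f i))"
    by metis
  have "(\<lambda>i. Suc (f i)) \<in> {..<nU I} \<rightarrow> {1, 2}" "(\<lambda>j. Suc (g j)) \<in> {..<nV I} \<rightarrow> {1, 2, 3}"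
    using f g by (auto simp: less_2_iff less_3_iff)
  moreover have "\<forall>(i, j) \<in> edges I. pc I i j (Suc (g j)) (Suc (f i)) = Plus"
    using assms g by (auto simp: ecbgc_instance_def bad_def)
  ultimately show "ecbgc_colorable I"
    unfolding ecbgc_colorable_def
    by (intro bexI[of _ "\<lambda>i. Suc (f i)"] bexI[of _ "\<lambda>j. Suc (g j)"])
qed

text \<open>If a color \<open>l\<close> is free at \<open>j\<close> while the other two are in
  conflict, then \<open>l\<close> is the redundant one. Being free, it is not excluded outright, so
  it is dominated by one of the other two, which would be free as well. Conversely, if all three
  colors are blocked, the two that differ from a redundant one yield a conflict.\<close>

lemma colorable_iff_no_conflict:
  assumes "ecbgc_instance I" and red: "\<forall>j<nV I. \<exists>k<3. redundant I j k"
  shows "ecbgc_colorable I \<longleftrightarrow>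
    (\<exists>f. (\<forall>i<nU I. f i < 2) \<and> (\<forall>i<nU I. \<forall>i'<nU I. \<not> conflict I i (f i) i' (f i')))"
proof -
  have "(\<forall>j<nV I. \<exists>k<3. \<forall>i<nU I. \<not> bad I i j k (f i)) \<longleftrightarrow>
      (\<forall>i<nU I. \<forall>i'<nU I. \<not> conflict I i (f i) i' (f i'))" (is "?A \<longleftrightarrow> ?B")
    if f: "\<forall>i<nU I. f i < 2" for f
  proof
    assume ?A
    show ?B
    proof (intro allI impI notI)
      fix i i' assume i: "i < nU I" "i' < nU I" "conflict I i (f i) i' (f i')"
      from i(3) obtain j k k' where k: "j < nV I" "k < 3" "k' < 3" "k \<noteq> k'"
        "redundant I j (3 - k - k')" "bad I i j k (f i)" "bad I i' j k' (f i')"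
        unfolding conflict_def by (elim exE conjE)
      obtain l where l: "l < 3" "\<forall>i<nU I. \<not> bad I i j l (f i)"
        using \<open>?A\<close> k(1) by blast
      have "l \<noteq> k" "l \<noteq> k'"
        using l(2)[rule_format, OF i(1)] l(2)[rule_format, OF i(2)] k(6,7) by metis+
      then have "l = 3 - k - k'"
        using l(1) k(2-4) unfolding less_3_iff by (elim disjE) simp_all
      moreover have "\<not> (bad I u j l 0 \<and> bad I u j l 1)" if u: "u < nU I" for u
      proof -
        have "f u = 0 \<or> f u = 1"
          using f u by (simp add: less_2_iff)
        then show ?thesis
          using l(2)[rule_format, OF u] by (elim disjE) simp_all
      qed
      ultimately obtain l' where l': "l' < 3" "l' \<noteq> l" "\<forall>i<nU I. \<forall>s<2. bad I i j l' s \<longrightarrow> bad I i j l s"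
        using k(5) unfolding redundant_def by metis
      have l'_ok: "\<not> bad I u j l' (f u)" if u: "u < nU I" for u
        using l(2)[rule_format, OF u] l'(3)[rule_format, OF u f[rule_format, OF u]] by metis
      have "l' = k \<or> l' = k'"
        using k(2-4) l'(1,2) \<open>l = 3 - k - k'\<close> unfolding less_3_iff by (elim disjE) simp_all
      then show False
        using l'_ok[OF i(1)] l'_ok[OF i(2)] k(6,7) by (elim disjE) simp_all
    qed
  next
    assume ?B
    show ?A
    proof (intro allI impI, rule ccontr)
      fix j assume j: "j < nV I" and no: "\<not> (\<exists>k<3. \<forall>i<nU I. \<not> bad I i j k (f i))"
      obtain l where l: "l < 3" "redundant I j l" using red j by blast
      obtain k k' where k: "k < 3" "k' < 3" "k \<noteq> k'" "l = 3 - k - k'"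
      proof
        show "(if l = 0 then 1 else 0) < (3::nat)" "(if l = 2 then 1 else 2) < (3::nat)"
          "(if l = 0 then 1 else 0) \<noteq> (if l = 2 then 1 else 2 :: nat)"
          "l = 3 - (if l = 0 then 1 else 0) - (if l = 2 then 1 else 2)"
          using l(1) by (auto simp: less_3_iff)
      qed
      obtain i where i: "i < nU I" "bad I i j k (f i)"
        using no k(1) by auto
      obtain i' where i': "i' < nU I" "bad I i' j k' (f i')"
        using no k(2) by auto
      have "conflict I i (f i) i' (f i')"
        unfolding conflict_def using j k(1-3) l(2)[unfolded k(4)] i(2) i'(2)
        by (intro exI[of _ j] exI[of _ k] exI[of _ k'] conjI)
      with \<open>?B\<close> i(1) i'(1) show False by simp
    qed
  qed
  then show ?thesis
    unfolding ecbgc_colorable_iff[OF assms(1)] by (simp cong: conj_cong)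
qed

text \<open>The literal \<open>2 * i + s\<close> says that vertex \<open>i\<close> of \<open>U\<close> has color \<open>s\<close>.\<close>

definition implications :: "ecbgc \<Rightarrow> (nat \<times> nat) set" where
  "implications I = {(2 * i + s, 2 * i' + (1 - s')) | i s i' s'.
     i < nU I \<and> s < 2 \<and> i' < nU I \<and> s' < 2 \<and> conflict I i s i' s'}"

definition negation :: "nat \<Rightarrow> nat" where
  "negation x = (if even x then x + 1 else x - 1)"

lemma negation_literal: "s < 2 \<Longrightarrow> negation (2 * i + s) = 2 * i + (1 - s)"
  by (auto simp: negation_def less_2_iff)

lemma literal_cases:
  fixes x :: nat
  obtains i s where "x = 2 * i + s" "s < 2"
proof
  show "x = 2 * (x div 2) + x mod 2" "x mod 2 < 2" by simp_all
qed

lemma negation_negation: "negation (negation x) = x"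
proof (rule literal_cases[of x])
  fix i s assume "x = 2 * i + s" "s < 2"
  then show ?thesis
    using negation_literal[of s i] negation_literal[of "1 - s" i] by simp
qed

lemma negation_neq: "negation x \<noteq> x"
proof (rule literal_cases[of x])
  fix i s assume "x = 2 * i + s" "s < 2"
  then show ?thesis
    using negation_literal[of s i] unfolding less_2_iff by auto
qed

lemma negation_less: "x < 2 * n \<Longrightarrow> negation x < 2 * n"
proof (rule literal_cases[of x])
  fix i s assume "x < 2 * n" "x = 2 * i + s" "s < 2"
  then show ?thesis
    using negation_literal[of s i] unfolding less_2_iff by auto
qed

lemma implications_subset: "implications I \<subseteq> {..<2 * nU I} \<times> {..<2 * nU I}"
  by (auto simp: implications_def)

text \<open>A conflict is a 2-clause, and its two implications are contrapositives of each other;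
  both are present because \<open>conflict\<close> is symmetric.\<close>

lemma implications_contra:
  assumes "(x, y) \<in> implications I"
  shows "(negation y, negation x) \<in> implications I"
proof -
  obtain i s i' s' where *: "x = 2 * i + s" "y = 2 * i' + (1 - s')" "i < nU I" "s < 2" "i' < nU I"
    "s' < 2" "conflict I i s i' s'"
    using assms by (auto simp: implications_def)
  have "negation y = 2 * i' + s'"
    using * negation_literal[of "1 - s'" i'] by auto
  moreover have "negation x = 2 * i + (1 - s)"
    using * negation_literal[of s i] by auto
  ultimately show ?thesis
    using * conflict_sym unfolding implications_def by blast
qed

lemma implications_trancl_contra:
  "(x, y) \<in> (implications I)\<^sup>+ \<Longrightarrow> (negation y, negation x) \<in> (implications I)\<^sup>+"
  by (induction rule: trancl_induct)
    (auto intro: implications_contra trancl_into_trancl2)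

text \<open>The literals true under a conflict-free coloring are closed under implication, so no
  cycle can contain both literals of a vertex. Conversely, a coloring is read off from the set that
  \<open>implications_satisfiable\<close> provides.\<close>

theorem colorable_iff_no_cycle:
  assumes "ecbgc_instance I" "\<forall>j<nV I. \<exists>k<3. redundant I j k"
  shows "ecbgc_colorable I \<longleftrightarrow> \<not> (\<exists>i<nU I. (2 * i, 2 * i + 1) \<in> (implications I)\<^sup>+ \<and>
    (2 * i + 1, 2 * i) \<in> (implications I)\<^sup>+)"
proof
  assume "ecbgc_colorable I"
  then obtain f where f: "\<forall>i<nU I. f i < 2"
    "\<forall>i<nU I. \<forall>i'<nU I. \<not> conflict I i (f i) i' (f i')"
    unfolding colorable_iff_no_conflict[OF assms] by (elim exE conjE)
  let ?T = "\<lambda>x. x mod 2 = f (x div 2)"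
  have lit: "(2 * i + s) div 2 = i" "(2 * i + s) mod 2 = s" if "s < 2" for i s :: nat
    using that by auto
  have step: "?T y" if xy: "(x, y) \<in> implications I" and x: "?T x" for x y
  proof -
    obtain i s i' s' where *: "x = 2 * i + s" "y = 2 * i' + (1 - s')" "i < nU I" "s < 2" "i' < nU I"
      "s' < 2" "conflict I i s i' s'"
      using xy by (auto simp: implications_def)
    have "s = f i"
      using x lit[OF *(4), of i] *(1) by simp
    then have "s' \<noteq> f i'"
      using *(3,5,7) f(2) by metis
    moreover have "f i' < 2" using f(1) *(5) by simp
    ultimately have "f i' = 1 - s'" using *(6) by linarith
    then show ?thesis
      using lit[of "1 - s'" i'] *(2) by simp
  qed
  have reach: "?T y" if "(x, y) \<in> (implications I)\<^sup>+" "?T x" for x y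
    using that by (induction rule: trancl_induct) (rule step; assumption)+
  show "\<not> (\<exists>i<nU I. (2 * i, 2 * i + 1) \<in> (implications I)\<^sup>+ \<and> (2 * i + 1, 2 * i) \<in> (implications I)\<^sup>+)"
  proof clarify
    fix i assume i: "i < nU I" "(2 * i, 2 * i + 1) \<in> (implications I)\<^sup>+"
      "(2 * i + 1, 2 * i) \<in> (implications I)\<^sup>+"
    have "f i = 0 \<or> f i = 1" using i f less_2_iff by blast
    then show False
      using reach[OF i(2)] reach[OF i(3)] by auto
  qed
next
  assume no: "\<not> (\<exists>i<nU I. (2 * i, 2 * i + 1) \<in> (implications I)\<^sup>+ \<and>
    (2 * i + 1, 2 * i) \<in> (implications I)\<^sup>+)"
  let ?L = "{..<2 * nU I}"
  have "\<exists>T. (\<forall>x\<in>?L. negation x \<in> T \<longleftrightarrow> x \<notin> T) \<and> (\<forall>(x, y)\<in>(implications I)\<^sup>+. x \<in> T \<longrightarrow> y \<in> T)"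
  proof (rule implications_satisfiable)
    show "(implications I)\<^sup>+ \<subseteq> ?L \<times> ?L"
      using implications_subset by (metis trancl_subset_Sigma)
    show "negation x \<in> ?L \<and> negation (negation x) = x" if "x \<in> ?L" for x
      using that by (simp add: negation_less negation_negation)
    show "\<not> ((x, negation x) \<in> (implications I)\<^sup>+ \<and> (negation x, x) \<in> (implications I)\<^sup>+)"
      if "x \<in> ?L" for x
    proof (rule literal_cases[of x])
      fix i s assume x: "x = 2 * i + s" "s < 2"
      then have i: "i < nU I" using that by simp
      have "s = 0 \<or> s = 1" using x(2) by (simp add: less_2_iff)
      then show ?thesis
      proof
        assume "s = 0"
        then show ?thesis using no i x(1) negation_literal[of 0 i] by simp
      next
        assume "s = 1"
        then show ?thesis using no i x(1) negation_literal[of 1 i] by auto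
      qed
    qed
  qed (simp_all add: trans_trancl negation_neq implications_trancl_contra)
  then obtain T where T: "\<forall>x<2 * nU I. negation x \<in> T \<longleftrightarrow> x \<notin> T"
    "\<forall>(x, y)\<in>(implications I)\<^sup>+. x \<in> T \<longrightarrow> y \<in> T"
    unfolding lessThan_iff Ball_def by (elim exE conjE)
  define f where "f i = (if 2 * i \<in> T then 0 else 1 :: nat)" for i
  have f: "2 * i + f i \<in> T" "2 * i + (1 - f i) \<notin> T" "f i < 2" if "i < nU I" for i
    using T(1)[rule_format, of "2 * i"] that by (auto simp: f_def negation_def)
  have "\<not> conflict I i (f i) i' (f i')" if "i < nU I" "i' < nU I" for i i'
  proof
    assume "conflict I i (f i) i' (f i')"
    then have "(2 * i + f i, 2 * i' + (1 - f i')) \<in> implications I"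
      unfolding implications_def using that f(3)[OF that(1)] f(3)[OF that(2)] by blast
    then have "(2 * i + f i, 2 * i' + (1 - f i')) \<in> (implications I)\<^sup>+"
      by (rule r_into_trancl)
    from bspec[OF T(2) this] show False
      using f(1)[OF that(1)] f(2)[OF that(2)] by simp
  qed
  then show "ecbgc_colorable I"
    unfolding colorable_iff_no_conflict[OF assms] using f(3) by (intro exI[of _ f]) simp
qed

section \<open>The program\<close>

text \<open>Any positive value counts as true. Hence sums act as disjunctions, and truncated
  subtraction from 1 is negation.\<close>

definition Neg :: "exp \<Rightarrow> exp" where "Neg a = Minus' (C 1) a"
definition Conj :: "exp \<Rightarrow> exp \<Rightarrow> exp" where "Conj a b = Neg (Plus' (Neg a) (Neg b))"
definition Eq :: "exp \<Rightarrow> exp \<Rightarrow> exp" where "Eq a b = Neg (Plus' (Minus' a b) (Minus' b a))"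
definition Disj :: "exp \<Rightarrow> exp \<Rightarrow> exp" where "Disj a b = Plus' a b"
definition Exists :: "nat \<Rightarrow> exp \<Rightarrow> exp \<Rightarrow> exp" where "Exists x a b = Sum x a b"
definition Forall :: "nat \<Rightarrow> exp \<Rightarrow> exp \<Rightarrow> exp" where "Forall x a b = Neg (Exists x a (Neg b))"

text \<open>Variable 0 serves as a dummy and must not occur in \<open>b\<close>.\<close>

definition Times :: "exp \<Rightarrow> exp \<Rightarrow> exp" where "Times a b = Sum 0 a b"

abbreviation holds :: "exp \<Rightarrow> (nat \<Rightarrow> nat) \<Rightarrow> (nat \<Rightarrow> nat) \<Rightarrow> bool" where
  "holds e s m \<equiv> 0 < eval e s m"

lemma sum_pos_iff: "0 < (\<Sum>i<n. f i) \<longleftrightarrow> (\<exists>i<n. 0 < f i)" for f :: "nat \<Rightarrow> nat"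
  by (induction n) (auto simp: less_Suc_eq)

lemma holds_simps [simp]:
  "holds (Neg a) s m \<longleftrightarrow> \<not> holds a s m"
  "holds (Conj a b) s m \<longleftrightarrow> holds a s m \<and> holds b s m"
  "holds (Disj a b) s m \<longleftrightarrow> holds a s m \<or> holds b s m"
  "holds (Eq a b) s m \<longleftrightarrow> eval a s m = eval b s m"
  "holds (Exists x a b) s m \<longleftrightarrow> (\<exists>i<eval a s m. holds b (s(x := i)) m)"
  "holds (Forall x a b) s m \<longleftrightarrow> (\<forall>i<eval a s m. holds b (s(x := i)) m)"
proof -
  have neg: "holds (Neg a) s m \<longleftrightarrow> \<not> holds a s m" for a s m
    unfolding Neg_def eval.simps by linarith
  have exi: "holds (Exists x a b) s m \<longleftrightarrow> (\<exists>i<eval a s m. holds b (s(x := i)) m)" for x a b s m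
    by (simp only: Exists_def eval.simps sum_pos_iff)
  show "holds (Neg a) s m \<longleftrightarrow> \<not> holds a s m" by (rule neg)
  show "holds (Exists x a b) s m \<longleftrightarrow> (\<exists>i<eval a s m. holds b (s(x := i)) m)" by (rule exi)
  show "holds (Forall x a b) s m \<longleftrightarrow> (\<forall>i<eval a s m. holds b (s(x := i)) m)"
    by (simp add: Forall_def neg exi)
  show "holds (Conj a b) s m \<longleftrightarrow> holds a s m \<and> holds b s m"
    by (simp add: Conj_def neg)
  show "holds (Disj a b) s m \<longleftrightarrow> holds a s m \<or> holds b s m"
    by (simp add: Disj_def)
  show "holds (Eq a b) s m \<longleftrightarrow> eval a s m = eval b s m"
    unfolding Eq_def neg eval.simps by linarith
qed

lemma eval_Forall: "eval (Forall x a b) s m = of_bool (\<forall>i<eval a s m. holds b (s(x := i)) m)"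
proof -
  have of_bool: "v = of_bool (0 < v)" if "v \<le> 1" for v :: nat
    using that by (cases v) auto
  have "eval (Forall x a b) s m = of_bool (holds (Forall x a b) s m)"
    by (rule of_bool) (simp add: Forall_def Neg_def)
  then show ?thesis by (simp only: holds_simps)
qed

lemma eval_Times: "eval (Times a b) s m = (\<Sum>i<eval a s m. eval b (s(0 := i)) m)"
  by (simp add: Times_def)

text \<open>The number of consecutive ones from address \<open>b\<close> on, provided that it is less than the
  length of the input.\<close>

definition unary_exp :: "exp \<Rightarrow> exp" where
  "unary_exp b = Sum 20 (V 1) (Forall 21 (Plus' (V 20) (C 1)) (Mem (Plus' b (V 21))))"

text \<open>Numbers cannot be stored, so the sizes of the parts are recounted from the unary
  prefixes at every use.\<close>

definition nU_exp :: exp where "nU_exp = unary_exp (C 0)"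
definition nV_exp :: exp where "nV_exp = unary_exp (Plus' nU_exp (C 1))"

text \<open>The 2 accounts for the terminators of the unary numbers, the 7 for the edge bit and the
  six values of \<open>pc\<close>.\<close>

definition entry_exp :: "nat \<Rightarrow> nat \<Rightarrow> exp" where
  "entry_exp i j = Plus' (Plus' (Plus' nU_exp nV_exp) (C 2))
     (Times (C 7) (Plus' (Times nV_exp (V i)) (V j)))"

text \<open>Within an entry the color of the \<open>U\<close> vertex varies fastest, which gives the
  offset \<open>1 + 2 * k + s\<close> behind the edge bit.\<close>

definition bad_exp :: "nat \<Rightarrow> nat \<Rightarrow> exp \<Rightarrow> exp \<Rightarrow> exp" where
  "bad_exp i j k s = Conj (Mem (entry_exp i j))
     (Neg (Mem (Plus' (entry_exp i j) (Plus' (C 1) (Plus' (Plus' k k) s)))))"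

definition redundant_exp :: "nat \<Rightarrow> exp \<Rightarrow> exp" where
  "redundant_exp j k =
     Disj (Exists 12 nU_exp (Conj (bad_exp 12 j k (C 0)) (bad_exp 12 j k (C 1))))
       (Exists 13 (C 3) (Conj (Neg (Eq (V 13) k))
          (Forall 12 nU_exp (Forall 14 (C 2)
             (Disj (Neg (bad_exp 12 j (V 13) (V 14))) (bad_exp 12 j k (V 14)))))))"

definition conflict_exp :: "nat \<Rightarrow> nat \<Rightarrow> nat \<Rightarrow> nat \<Rightarrow> exp" where
  "conflict_exp i s i' s' =
     Exists 9 nV_exp (Exists 10 (C 3) (Exists 11 (C 3) (Conj (Conj (Neg (Eq (V 10) (V 11)))
       (redundant_exp 9 (Minus' (Minus' (C 3) (V 10)) (V 11))))
       (Conj (bad_exp i 9 (V 10) (V s)) (bad_exp i' 9 (V 11) (V s'))))))"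

definition lits_exp :: exp where "lits_exp = Times (C 2) nU_exp"

text \<open>Variables 2 and 3 are the row and column supplied by \<open>update_com\<close>. Capture
  is avoided by disjoint ranges: 5 to 8 here, 9 to 11 for conflicts, 12 to 14 for redundancy, 20 and
  21 for unary numbers.\<close>

definition implication_exp :: exp where
  "implication_exp =
     Exists 5 nU_exp (Exists 6 (C 2) (Exists 7 nU_exp (Exists 8 (C 2)
       (Conj (Conj (Eq (V 2) (Plus' (Plus' (V 5) (V 5)) (V 6)))
          (Eq (V 3) (Plus' (Plus' (V 7) (V 7)) (Minus' (C 1) (V 8)))))
          (conflict_exp 5 6 7 8)))))"

text \<open>A relation on literals is kept behind the input as a matrix in row-major order.\<close>

definition addr_exp :: "exp \<Rightarrow> exp \<Rightarrow> exp" where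
  "addr_exp x y = Plus' (Plus' (V 1) (Times lits_exp x)) y"

text \<open>The disjunction with the old entry replaces a conditional: entries are set but never
  cleared.\<close>

definition update_com :: "exp \<Rightarrow> com" where
  "update_com e = For 2 lits_exp (For 3 lits_exp
     (Asg (addr_exp (V 2) (V 3)) (Disj (Mem (addr_exp (V 2) (V 3))) e)))"

definition closure_com :: com where
  "closure_com = For 4 lits_exp
     (update_com (Conj (Mem (addr_exp (V 2) (V 4))) (Mem (addr_exp (V 4) (V 3)))))"

text \<open>Cell 0 holds an input bit. It is overwritten only here, after the last expression has
  been evaluated.\<close>

definition answer_com :: com where
  "answer_com = Asg (C 0) (Neg (Exists 5 nU_exp
     (Conj (Mem (addr_exp (Plus' (V 5) (V 5)) (Plus' (Plus' (V 5) (V 5)) (C 1))))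
        (Mem (addr_exp (Plus' (Plus' (V 5) (V 5)) (C 1)) (Plus' (V 5) (V 5)))))))"

definition ecbgc_com :: com where
  "ecbgc_com = Seq (update_com implication_exp) (Seq closure_com answer_com)"

section \<open>Reading the input\<close>

lemma nth_concat_uniform:
  assumes "\<forall>xs\<in>set xss. length xs = k" "i < length xss" "t < k"
  shows "concat xss ! (k * i + t) = xss ! i ! t"
  using assms
proof (induction xss arbitrary: i)
  case (Cons xs xss)
  then show ?case
    by (cases i) (auto simp: nth_append add.assoc)
qed simp

lemma length_concat_uniform:
  assumes "\<forall>xs\<in>set xss. length xs = k"
  shows "length (concat xss) = k * length xss"
  using assms by (induction xss) auto

lemma length_encode_entry: "length (encode_entry I i j) = 7"
  by (simp add: encode_entry_def)

definition matrix_entries :: "ecbgc \<Rightarrow> bool list list" where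
  "matrix_entries I = concat [[encode_entry I i j. j \<leftarrow> [0..<nV I]]. i \<leftarrow> [0..<nU I]]"

lemma encode_ecbgc_eq: "encode_ecbgc I =
  replicate (nU I) True @ [False] @ replicate (nV I) True @ [False] @ concat (matrix_entries I)"
  by (simp add: encode_ecbgc_def matrix_entries_def)

lemma length_matrix_entries: "length (matrix_entries I) = nV I * nU I"
  unfolding matrix_entries_def by (subst length_concat_uniform[of _ "nV I"]) auto

lemma length_encode_ecbgc: "length (encode_ecbgc I) = nU I + nV I + 2 + 7 * (nV I * nU I)"
proof -
  have "length (concat (matrix_entries I)) = 7 * length (matrix_entries I)"
    by (rule length_concat_uniform) (auto simp: matrix_entries_def length_encode_entry)
  then show ?thesis by (simp add: encode_ecbgc_eq length_matrix_entries)
qed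

lemma nth_encode_ecbgc_nU:
  "y < nU I \<Longrightarrow> encode_ecbgc I ! y" "\<not> encode_ecbgc I ! nU I"
  by (auto simp: encode_ecbgc_eq nth_append)

lemma nth_encode_ecbgc_nV:
  "y < nV I \<Longrightarrow> encode_ecbgc I ! (nU I + 1 + y)" "\<not> encode_ecbgc I ! (nU I + 1 + nV I)"
  by (auto simp: encode_ecbgc_eq nth_append)

lemma nth_encode_ecbgc_entry:
  assumes "i < nU I" "j < nV I" "t < 7"
  shows "encode_ecbgc I ! (nU I + nV I + 2 + 7 * (nV I * i + j) + t) = encode_entry I i j ! t"
    and "nU I + nV I + 2 + 7 * (nV I * i + j) + t < length (encode_ecbgc I)"
proof -
  have "nV I * i + j < nV I * Suc i" using assms by simp
  also have "\<dots> \<le> nV I * nU I" using assms by (intro mult_le_mono2) simp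
  finally have lt: "nV I * i + j < nV I * nU I" .
  have "matrix_entries I ! (nV I * i + j) = [encode_entry I i j. j \<leftarrow> [0..<nV I]] ! j"
    unfolding matrix_entries_def using assms by (subst nth_concat_uniform) auto
  also have "\<dots> = encode_entry I i j" using assms by simp
  finally have e: "concat (matrix_entries I) ! (7 * (nV I * i + j) + t) = encode_entry I i j ! t"
    using assms lt
    by (subst nth_concat_uniform[of _ 7])
      (auto simp: length_matrix_entries, auto simp: matrix_entries_def length_encode_entry)
  have "encode_ecbgc I ! (nU I + nV I + 2 + x) = concat (matrix_entries I) ! x" for x
    by (simp add: encode_ecbgc_eq nth_append)
  from this[of "7 * (nV I * i + j) + t"] e
  show "encode_ecbgc I ! (nU I + nV I + 2 + 7 * (nV I * i + j) + t) = encode_entry I i j ! t"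
    by (simp add: add.assoc)
  show "nU I + nV I + 2 + 7 * (nV I * i + j) + t < length (encode_ecbgc I)"
    using lt assms(3) by (simp add: length_encode_ecbgc)
qed

lemma nth_encode_entry:
  "encode_entry I i j ! 0 \<longleftrightarrow> (i, j) \<in> edges I"
  "k < 3 \<Longrightarrow> s < 2 \<Longrightarrow> encode_entry I i j ! Suc (k + k + s) \<longleftrightarrow>
    (i, j) \<in> edges I \<and> pc I i j (Suc k) (Suc s) = Plus"
  using less_3_iff[of k] less_2_iff[of s]
  by (simp_all add: encode_entry_def) (elim disjE; simp add: numeral_2_eq_2 numeral_3_eq_3)

text \<open>The memory is constrained on the input only, so this survives all writes to the matrix
  behind it.\<close>

definition loaded :: "ecbgc \<Rightarrow> (nat \<Rightarrow> nat) \<Rightarrow> (nat \<Rightarrow> nat) \<Rightarrow> bool" where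
  "loaded I s m \<longleftrightarrow> s 1 = length (encode_ecbgc I) \<and>
     (\<forall>a<length (encode_ecbgc I). m a = of_bool (encode_ecbgc I ! a))"

lemma loaded_upd [simp]: "x \<noteq> 1 \<Longrightarrow> loaded I (s(x := v)) m \<longleftrightarrow> loaded I s m"
  by (simp add: loaded_def)

section \<open>Values of the expressions on an encoded instance\<close>

lemma eval_unary_exp:
  assumes "\<And>u v. eval b (s(20 := u, 21 := v)) m = a"
    and "\<And>y. y < n \<Longrightarrow> 0 < m (a + y)" "m (a + n) = 0" "n \<le> s 1"
  shows "eval (unary_exp b) s m = n"
proof -
  \<comment> \<open>The index \<open>x\<close> is counted iff the cells from \<open>a\<close> to
    \<open>a + x\<close> are all positive; the zero at \<open>a + n\<close> stops the count.\<close>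
  have "(\<forall>y<Suc x. 0 < m (a + y)) \<longleftrightarrow> x < n" for x
    using assms(2,3) by (metis less_Suc_eq less_irrefl_nat linorder_neqE_nat less_trans)
  then have "eval (unary_exp b) s m = (\<Sum>x<s 1. of_bool (x < n))"
    by (simp add: unary_exp_def eval_Forall assms(1))
  also have "\<dots> = card ({..<s 1} \<inter> {x. x < n})"
    by simp
  also have "{..<s 1} \<inter> {x. x < n} = {..<n}"
    using assms(4) by auto
  finally show ?thesis by simp
qed

lemma eval_nU_exp [simp]:
  assumes "loaded I s m"
  shows "eval nU_exp s m = nU I"
  unfolding nU_exp_def
  by (rule eval_unary_exp[where a = 0])
    (use assms in \<open>auto simp: loaded_def length_encode_ecbgc nth_encode_ecbgc_nU\<close>)

lemma eval_nV_exp [simp]: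
  assumes "loaded I s m"
  shows "eval nV_exp s m = nV I"
proof -
  have m: "m a = of_bool (encode_ecbgc I ! a)" if "a < length (encode_ecbgc I)" for a
    using assms that by (simp add: loaded_def)
  show ?thesis
    unfolding nV_exp_def
  proof (rule eval_unary_exp[where a = "nU I + 1"])
    show "0 < m (nU I + 1 + y)" if "y < nV I" for y
      using that nth_encode_ecbgc_nV(1)[OF that] by (subst m) (auto simp: length_encode_ecbgc)
    show "m (nU I + 1 + nV I) = 0"
      using nth_encode_ecbgc_nV(2)[of I] by (subst m) (auto simp: length_encode_ecbgc)
    show "nV I \<le> s 1"
      using assms by (simp add: loaded_def length_encode_ecbgc)
  qed (use assms in simp)
qed

lemma eval_entry_exp [simp]:
  assumes "loaded I s m" "i \<noteq> 0" "j \<noteq> 0"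
  shows "eval (entry_exp i j) s m = nU I + nV I + 2 + 7 * (nV I * s i + s j)"
  using assms by (simp add: entry_exp_def eval_Times)

lemma holds_bad_exp [simp]:
  assumes "loaded I s m" "i \<noteq> 0" "j \<noteq> 0" "s i < nU I" "s j < nV I"
    "eval k s m < 3" "eval t s m < 2"
  shows "holds (bad_exp i j k t) s m \<longleftrightarrow> bad I (s i) (s j) (eval k s m) (eval t s m)"
proof -
  let ?t = "Suc (eval k s m + eval k s m + eval t s m)"
  have t: "?t < 7" using assms by simp
  have "m (nU I + nV I + 2 + 7 * (nV I * s i + s j) + u) = of_bool (encode_entry I (s i) (s j) ! u)"
    if "u < 7" for u
    using nth_encode_ecbgc_entry[OF assms(4,5) that] assms(1) by (simp add: loaded_def)
  from this[of 0] this[OF t] show ?thesis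
    using assms by (auto simp: bad_exp_def bad_def nth_encode_entry)
qed

text \<open>The conditions on \<open>k\<close> say that the variables bound in
  \<open>redundant_exp\<close> do not capture anything in it.\<close>

lemma holds_redundant_exp:
  assumes "loaded I s m" "j \<notin> {0, 12, 13, 14}" "s j < nV I" "eval k s m < 3"
    and "\<And>u. eval k (s(12 := u)) m = eval k s m" "\<And>u. eval k (s(13 := u)) m = eval k s m"
    "\<And>u v w. eval k (s(13 := u, 12 := v, 14 := w)) m = eval k s m"
  shows "holds (redundant_exp j k) s m \<longleftrightarrow> redundant I (s j) (eval k s m)"
  using assms
  by (auto simp: redundant_exp_def redundant_def imp_conv_disj[symmetric] cong: conj_cong imp_cong)

lemma holds_conflict_exp:
  assumes "loaded I s m" "i \<notin> {0, 9, 10, 11}" "i' \<notin> {0, 9, 10, 11}"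
    "t \<notin> {0, 9, 10, 11}" "t' \<notin> {0, 9, 10, 11}" "s i < nU I" "s i' < nU I" "s t < 2" "s t' < 2"
  shows "holds (conflict_exp i t i' t') s m \<longleftrightarrow> conflict I (s i) (s t) (s i') (s t')"
proof -
  have "3 - k - k' < (3::nat)" if "k \<noteq> k'" for k k' :: nat
    using that by auto
  with assms show ?thesis
    by (auto simp: conflict_exp_def conflict_def holds_redundant_exp cong: conj_cong)
qed

text \<open>The bounded quantifiers are nested as in \<open>implication_exp\<close>, so that the two
  can be matched by rewriting.\<close>

lemma implications_iff:
  "(x, y) \<in> implications I \<longleftrightarrow> (\<exists>i<nU I. \<exists>s<2. \<exists>i'<nU I. \<exists>s'<2.
     (x = i + i + s \<and> y = i' + i' + (1 - s')) \<and> conflict I i s i' s')"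
  unfolding implications_def mult_2 by blast

lemma holds_implication_exp:
  assumes "loaded I s m"
  shows "holds implication_exp s m \<longleftrightarrow> (s 2, s 3) \<in> implications I"
  using assms
  by (simp add: implication_exp_def implications_iff holds_conflict_exp cong: conj_cong)

section \<open>Correctness of the program\<close>

definition addr :: "ecbgc \<Rightarrow> nat \<Rightarrow> nat \<Rightarrow> nat" where
  "addr I x y = length (encode_ecbgc I) + 2 * nU I * x + y"

definition stored :: "ecbgc \<Rightarrow> (nat \<Rightarrow> nat) \<Rightarrow> (nat \<times> nat) set" where
  "stored I m = {(x, y). x < 2 * nU I \<and> y < 2 * nU I \<and> 0 < m (addr I x y)}"

lemma addr_eq_iff:
  assumes "y < 2 * nU I" "y' < 2 * nU I"
  shows "addr I x y = addr I x' y' \<longleftrightarrow> x = x' \<and> y = y'"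
proof
  assume "addr I x y = addr I x' y'"
  then have e: "2 * nU I * x + y = 2 * nU I * x' + y'"
    by (simp add: addr_def)
  have "(2 * nU I * x + y) div (2 * nU I) = x" "(2 * nU I * x' + y') div (2 * nU I) = x'"
    using assms by auto
  with e have "x = x'" by metis
  with e show "x = x' \<and> y = y'" by simp
qed simp

lemma eval_lits_exp [simp]: "loaded I s m \<Longrightarrow> eval lits_exp s m = 2 * nU I"
  by (simp add: lits_exp_def eval_Times)

lemma eval_addr_exp [simp]:
  assumes "loaded I s m" "\<And>v. eval x (s(0 := v)) m = eval x s m"
  shows "eval (addr_exp x y) s m = addr I (eval x s m) (eval y s m)"
  using assms by (simp add: addr_exp_def addr_def eval_Times) (simp add: loaded_def)

lemma fold_simulation:
  assumes "Inv m" and "\<And>i m. i < n \<Longrightarrow> Inv m \<Longrightarrow> Inv (f i m) \<and> h (f i m) = g i (h m)"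
  shows "Inv (fold f [0..<n] m) \<and> h (fold f [0..<n] m) = fold g [0..<n] (h m)"
  using assms by (induction n) auto

lemma update_com_step:
  fixes I s m x y e
  defines "s' \<equiv> s(2 := x, 3 := y)"
  assumes "loaded I s m" "x < 2 * nU I" "y < 2 * nU I"
  defines "m' \<equiv> sem (Asg (addr_exp (V 2) (V 3)) (Disj (Mem (addr_exp (V 2) (V 3))) e)) s' m"
  shows "loaded I s m'"
    "stored I m' = (if holds e s' m then insert (x, y) (stored I m) else stored I m)"
proof -
  have m': "m' = m(addr I x y := of_bool (0 < m (addr I x y) \<or> holds e s' m))"
    using assms(2) by (simp add: m'_def s'_def)
  show "loaded I s m'"
    using assms(2) by (auto simp: m' loaded_def addr_def)
  show "stored I m' = (if holds e s' m then insert (x, y) (stored I m) else stored I m)"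
    using assms(3,4) by (auto simp: stored_def m' addr_eq_iff)
qed

text \<open>\<open>g\<close> is the effect of one entry update on the stored relation. Since
  \<open>e\<close> may read the matrix while it is being updated, this covers both the initial
  filling and a round of the closure.\<close>

lemma update_com_sem:
  assumes "loaded I s m"
    and step: "\<And>x y m. x < 2 * nU I \<Longrightarrow> y < 2 * nU I \<Longrightarrow> loaded I s m \<Longrightarrow>
      (if holds e (s(2 := x, 3 := y)) m then insert (x, y) (stored I m) else stored I m) =
        g x y (stored I m)"
  shows "loaded I s (sem (update_com e) s m) \<and>
    stored I (sem (update_com e) s m) =
      fold (\<lambda>x. fold (g x) [0..<2 * nU I]) [0..<2 * nU I] (stored I m)"
proof -
  let ?c = "Asg (addr_exp (V 2) (V 3)) (Disj (Mem (addr_exp (V 2) (V 3))) e)"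
  have inner: "loaded I s (sem (For 3 lits_exp ?c) (s(2 := x)) m) \<and>
      stored I (sem (For 3 lits_exp ?c) (s(2 := x)) m) = fold (g x) [0..<2 * nU I] (stored I m)"
    if "x < 2 * nU I" "loaded I s m" for x m
  proof -
    have "loaded I s (fold (\<lambda>y. sem ?c (s(2 := x, 3 := y))) [0..<2 * nU I] m) \<and>
        stored I (fold (\<lambda>y. sem ?c (s(2 := x, 3 := y))) [0..<2 * nU I] m) =
          fold (g x) [0..<2 * nU I] (stored I m)"
      by (rule fold_simulation[where Inv = "loaded I s" and h = "stored I"]) (use that update_com_step step in auto)
    then show ?thesis
      using that by simp
  qed
  have "loaded I s (fold (\<lambda>x. sem (For 3 lits_exp ?c) (s(2 := x))) [0..<2 * nU I] m) \<and>
      stored I (fold (\<lambda>x. sem (For 3 lits_exp ?c) (s(2 := x))) [0..<2 * nU I] m) =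
        fold (\<lambda>x. fold (g x) [0..<2 * nU I]) [0..<2 * nU I] (stored I m)"
    by (rule fold_simulation[where Inv = "loaded I s" and h = "stored I"]) (use assms(1) inner in auto)
  then show ?thesis
    using assms(1) by (simp add: update_com_def)
qed

lemma fold_insert_if:
  "fold (\<lambda>y S. if P y then insert (h y) S else S) ys = (\<lambda>S. S \<union> {h y |y. y \<in> set ys \<and> P y})"
  by (induction ys) (auto simp: fun_eq_iff)

lemma fold_union: "fold (\<lambda>x S. S \<union> F x) xs S = S \<union> (\<Union>x\<in>set xs. F x)"
  by (induction xs arbitrary: S) auto

lemma ecbgc_com_sem:
  assumes "loaded I s m" "stored I m = {}"
  shows "sem ecbgc_com s m 0 = of_bool (\<not> (\<exists>i<nU I. (2 * i, 2 * i + 1) \<in> (implications I)\<^sup>+ \<and>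
    (2 * i + 1, 2 * i) \<in> (implications I)\<^sup>+))"
proof -
  let ?L = "2 * nU I"
  define m1 where "m1 = sem (update_com implication_exp) s m"
  define m2 where "m2 = sem closure_com s m1"
  have m1: "loaded I s m1 \<and> stored I m1 = fold (\<lambda>x. fold (\<lambda>y S.
      if (x, y) \<in> implications I then insert (x, y) S else S) [0..<?L]) [0..<?L] (stored I m)"
    unfolding m1_def
    by (rule update_com_sem[OF assms(1)]) (simp add: holds_implication_exp)
  then have stored1: "stored I m1 = implications I"
    using implications_subset[of I]
    by (auto simp: fold_insert_if fold_union assms(2))
  let ?e = "Conj (Mem (addr_exp (V 2) (V 4))) (Mem (addr_exp (V 4) (V 3)))"
  have round: "loaded I s (sem (update_com ?e) (s(4 := k)) m) \<and>
      stored I (sem (update_com ?e) (s(4 := k)) m) =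
        fold (\<lambda>x. fold (warshall_step k x) [0..<?L]) [0..<?L] (stored I m)"
    if "k < ?L" "loaded I s m" for k m
  proof -
    have "loaded I (s(4 := k)) (sem (update_com ?e) (s(4 := k)) m) \<and>
      stored I (sem (update_com ?e) (s(4 := k)) m) =
        fold (\<lambda>x. fold (warshall_step k x) [0..<?L]) [0..<?L] (stored I m)"
      by (rule update_com_sem) (use that in \<open>auto simp: warshall_step_def stored_def\<close>)
    then show ?thesis by simp
  qed
  have "loaded I s (fold (\<lambda>k. sem (update_com ?e) (s(4 := k))) [0..<?L] m1) \<and>
      stored I (fold (\<lambda>k. sem (update_com ?e) (s(4 := k))) [0..<?L] m1) =
        fold (\<lambda>k. fold (\<lambda>x. fold (warshall_step k x) [0..<?L]) [0..<?L]) [0..<?L] (stored I m1)"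
    by (rule fold_simulation[where Inv = "loaded I s" and h = "stored I"]) (use m1 round in auto)
  then have m2: "loaded I s m2" "stored I m2 = (implications I)\<^sup>+"
    using conjunct1[OF m1] warshall_trancl[OF implications_subset]
    by (simp_all add: m2_def closure_com_def stored1)
  have "(x, y) \<in> (implications I)\<^sup>+ \<longleftrightarrow> 0 < m2 (addr I x y)" if "x < ?L" "y < ?L" for x y
    using that unfolding m2(2)[symmetric] by (simp add: stored_def)
  then have "sem answer_com s m2 0 = of_bool (\<not> (\<exists>i<nU I. (2 * i, 2 * i + 1) \<in> (implications I)\<^sup>+ \<and>
      (2 * i + 1, 2 * i) \<in> (implications I)\<^sup>+))"
    using m2(1) by (simp add: answer_com_def mult_2 cong: conj_cong)
  then show ?thesis
    by (simp add: ecbgc_com_def m1_def m2_def)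
qed

theorem theorem20:
  "poly_time_solvable_on
     {I. ecbgc_instance I \<and>
        (\<forall>j \<in> {..<nV I}. \<exists>a \<in> {1, 2, 3}. \<exists>b \<in> {1, 2, 3}. a \<noteq> b \<and>
           (\<forall>i \<in> {..<nU I}. (i, j) \<in> edges I \<longrightarrow>
              (pc I i j a 1 = Plus \<and> pc I i j b 2 = Plus \<longleftrightarrow>
               pc I i j a 2 = Plus \<and> pc I i j b 1 = Plus)))}
     encode_ecbgc ecbgc_colorable"
proof (rule poly_time_solvable_on_bounded_loops[of _ ecbgc_com], elim CollectE conjE)
  fix I
  assume inst: "ecbgc_instance I"
    and promise: "\<forall>j \<in> {..<nV I}. \<exists>a \<in> {1, 2, 3}. \<exists>b \<in> {1, 2, 3}. a \<noteq> b \<and>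
           (\<forall>i \<in> {..<nU I}. (i, j) \<in> edges I \<longrightarrow>
              (pc I i j a 1 = Plus \<and> pc I i j b 2 = Plus \<longleftrightarrow>
               pc I i j a 2 = Plus \<and> pc I i j b 1 = Plus))"
  let ?s = "(\<lambda>_. 0)(1 := length (encode_ecbgc I))" and ?m = "input_mem (encode_ecbgc I)"
  have "\<forall>j<nV I. \<exists>k<3. redundant I j k"
    using promise ex_redundant by (meson lessThan_iff)
  note colorable_iff_no_cycle[OF inst this]
  moreover have "loaded I ?s ?m"
    by (simp add: loaded_def input_mem_def)
  \<comment> \<open>The cells behind the input are still 0, so the matrix starts as the empty
    relation.\<close>
  moreover have "stored I ?m = {}"
    by (simp add: stored_def input_mem_def addr_def)
  ultimately show "sem ecbgc_com ?s ?m 0 = of_bool (ecbgc_colorable I)"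
    by (simp only: ecbgc_com_sem)
qed

end
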